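(* If $G$ is a finite, simple, connected graph other than $C_3$, $C_4$, $C_5$ or $K_{1,3}$, then there exists $K$ such that for all $k \geq K$ we have $D(L^k(G)) \leq 2$.
   Context: For a finite graph $G$, a map $f:V(G) \to \{1,\dotsc,k\}$ distinguishes $G$ if for every nontrivial automorphism $\phi$ of $G$ there is a vertex $v$ with $f(v) \neq f(\phi(v))$. The distinguishing number $D(G)$ is the least $k$ for which such a map exists. The line graph $L(G)$ has vertex set $E(G)$, two edges adjacent if they share an endpoint; $L^k(G) = L(L^{k-1}(G))$, $L^0(G)=G$. *)

theory Defs
  imports Main "HOL-Library.FSet"
begin

record 'a graph =
  verts :: "'a set"
  edges :: "'a set set"

definition finite_simple_graph :: "'a graph \<Rightarrow> bool" where
  "finite_simple_graph G \<longleftrightarrow>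
     finite (verts G) \<and> (\<forall>e\<in>edges G. e \<subseteq> verts G \<and> card e = 2)"

definition connected_graph :: "'a graph \<Rightarrow> bool" where
  "connected_graph G \<longleftrightarrow>
     (\<forall>u\<in>verts G. \<forall>v\<in>verts G. (u, v) \<in> {(x, y). {x, y} \<in> edges G}\<^sup>*)"

definition graph_isomorphism :: "('a \<Rightarrow> 'b) \<Rightarrow> 'a graph \<Rightarrow> 'b graph \<Rightarrow> bool" where
  "graph_isomorphism \<phi> G H \<longleftrightarrow>
     bij_betw \<phi> (verts G) (verts H) \<and>
     (\<forall>u\<in>verts G. \<forall>v\<in>verts G. {u, v} \<in> edges G \<longleftrightarrow> {\<phi> u, \<phi> v} \<in> edges H)"

definition isomorphic_graphs :: "'a graph \<Rightarrow> 'b graph \<Rightarrow> bool" where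
  "isomorphic_graphs G H \<longleftrightarrow> (\<exists>\<phi>. graph_isomorphism \<phi> G H)"

abbreviation graph_automorphism :: "('a \<Rightarrow> 'a) \<Rightarrow> 'a graph \<Rightarrow> bool" where
  "graph_automorphism \<phi> G \<equiv> graph_isomorphism \<phi> G G"

text \<open>Only the values of an automorphism on the vertex set matter, so ``nontrivial'' means
  moving some vertex of the graph.\<close>

definition distinguishes :: "('a \<Rightarrow> nat) \<Rightarrow> 'a graph \<Rightarrow> bool" where
  "distinguishes f G \<longleftrightarrow>
     (\<forall>\<phi>. graph_automorphism \<phi> G \<and> (\<exists>v\<in>verts G. \<phi> v \<noteq> v) \<longrightarrow>
          (\<exists>v\<in>verts G. f v \<noteq> f (\<phi> v)))"

definition distinguishing_number :: "'a graph \<Rightarrow> nat" where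
  "distinguishing_number G =
     (LEAST k. \<exists>f. f ` verts G \<subseteq> {1..k} \<and> distinguishes f G)"

text \<open>The set in the definition above is nonempty for finite graphs, so the minimum is attained.\<close>

lemma ex_distinguishing_map:
  assumes "finite (verts G)"
  shows "\<exists>k f. f ` verts G \<subseteq> {1..k} \<and> distinguishes f G"
proof -
  obtain h where h: "bij_betw h (verts G) {0..<card (verts G)}"
    using ex_bij_betw_finite_nat[OF assms] by blast
  let ?f = "\<lambda>v. Suc (h v)"
  have "?f ` verts G \<subseteq> {1..card (verts G)}"
    using bij_betwE[OF h] by (auto simp: Suc_le_eq)
  moreover have "distinguishes ?f G"
    unfolding distinguishes_def
  proof (intro allI impI, elim conjE bexE)
    fix \<phi> v
    assume "graph_automorphism \<phi> G" "v \<in> verts G" "\<phi> v \<noteq> v"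
    then have "\<phi> v \<in> verts G" "v \<in> verts G" "\<phi> v \<noteq> v"
      by (auto simp: graph_isomorphism_def bij_betw_def)
    then have "h v \<noteq> h (\<phi> v)"
      using h by (auto simp: bij_betw_def dest: inj_onD)
    with \<open>v \<in> verts G\<close> show "\<exists>v\<in>verts G. ?f v \<noteq> ?f (\<phi> v)"
      by auto
  qed
  ultimately show ?thesis
    by blast
qed

definition line_graph :: "'a graph \<Rightarrow> 'a set graph" where
  "line_graph G =
     \<lparr>verts = edges G,
      edges = {{e, f} | e f. e \<in> edges G \<and> f \<in> edges G \<and> e \<noteq> f \<and> e \<inter> f \<noteq> {}}\<rparr>"

text \<open>\<^const>\<open>line_graph\<close> changes the vertex type, so it cannot be iterated directly. After each
  step the vertices, which are finite sets, are therefore injected into one recursive type.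
  The lemmas \<open>iterated_line_graph_0_isomorphic\<close> and
  \<open>iterated_line_graph_Suc_isomorphic\<close> show that this only changes graphs up to
  isomorphism.\<close>

datatype 'a vertex = Base 'a | Edge "'a vertex fset"

definition relabel :: "('a \<Rightarrow> 'b) \<Rightarrow> 'a graph \<Rightarrow> 'b graph" where
  "relabel h G = \<lparr>verts = h ` verts G, edges = (\<lambda>e. h ` e) ` edges G\<rparr>"

primrec iterated_line_graph :: "nat \<Rightarrow> 'a graph \<Rightarrow> 'a vertex graph" where
  "iterated_line_graph 0 G = relabel Base G"
| "iterated_line_graph (Suc k) G =
     relabel (\<lambda>e. Edge (Abs_fset e)) (line_graph (iterated_line_graph k G))"

lemma finite_simple_line_graph:
  assumes "finite_simple_graph G"
  shows "finite_simple_graph (line_graph G)"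
proof -
  have "finite (edges G)"
    using assms unfolding finite_simple_graph_def
    by (auto intro!: finite_subset[of "edges G" "Pow (verts G)"])
  then show ?thesis
    unfolding finite_simple_graph_def line_graph_def by (auto simp: card_2_iff)
qed

lemma
  assumes G: "finite_simple_graph G" and inj: "inj_on h (verts G)"
  shows finite_simple_relabel: "finite_simple_graph (relabel h G)"
    and isomorphism_relabel: "graph_isomorphism h G (relabel h G)"
proof -
  have sub: "e \<subseteq> verts G" if "e \<in> edges G" for e
    using G that by (auto simp: finite_simple_graph_def)
  show "finite_simple_graph (relabel h G)"
    using G inj sub unfolding finite_simple_graph_def relabel_def
    by (auto simp: card_image inj_on_subset)
  have "{u, v} \<in> edges G \<longleftrightarrow> {h u, h v} \<in> (\<lambda>e. h ` e) ` edges G"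
    if "u \<in> verts G" "v \<in> verts G" for u v
  proof
    assume "{h u, h v} \<in> (\<lambda>e. h ` e) ` edges G"
    then obtain e where e: "e \<in> edges G" "h ` e = h ` {u, v}" by auto
    then have "e = {u, v}"
      using inj_on_image_eq_iff[OF inj sub[OF e(1)], of "{u, v}"] that by auto
    with e show "{u, v} \<in> edges G" by simp
  next
    assume "{u, v} \<in> edges G"
    then have "h ` {u, v} \<in> (\<lambda>e. h ` e) ` edges G" by (rule imageI)
    then show "{h u, h v} \<in> (\<lambda>e. h ` e) ` edges G" by simp
  qed
  with inj show "graph_isomorphism h G (relabel h G)"
    by (simp add: graph_isomorphism_def relabel_def bij_betw_def)
qed

lemma inj_on_Edge_line_graph:
  assumes "finite_simple_graph G"
  shows "inj_on (\<lambda>e. Edge (Abs_fset e)) (verts (line_graph G))"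
proof (rule inj_onI)
  fix e f
  assume "e \<in> verts (line_graph G)" "f \<in> verts (line_graph G)"
    and eq: "Edge (Abs_fset e) = Edge (Abs_fset f)"
  then have "finite e" "finite f"
    using assms by (auto simp: finite_simple_graph_def line_graph_def intro: finite_subset)
  with eq show "e = f"
    by (simp add: Abs_fset_inject)
qed

lemma finite_simple_iterated_line_graph:
  "finite_simple_graph G \<Longrightarrow> finite_simple_graph (iterated_line_graph k G)"
  by (induction k)
    (auto intro!: finite_simple_relabel finite_simple_line_graph inj_on_Edge_line_graph
      simp: inj_on_def)

lemma iterated_line_graph_0_isomorphic:
  assumes "finite_simple_graph G"
  shows "isomorphic_graphs G (iterated_line_graph 0 G)"
proof -
  have "inj_on Base (verts G)" by (simp add: inj_on_def)
  from isomorphism_relabel[OF assms this] show ?thesis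
    unfolding isomorphic_graphs_def by auto
qed

lemma iterated_line_graph_Suc_isomorphic:
  assumes "finite_simple_graph G"
  shows "isomorphic_graphs (line_graph (iterated_line_graph k G)) (iterated_line_graph (Suc k) G)"
proof -
  let ?H = "iterated_line_graph k G"
  have "finite_simple_graph ?H"
    using assms by (rule finite_simple_iterated_line_graph)
  from isomorphism_relabel[OF finite_simple_line_graph[OF this] inj_on_Edge_line_graph[OF this]]
  show ?thesis
    unfolding isomorphic_graphs_def by auto
qed

text \<open>This is the cycle \<open>C\<^sub>n\<close> only for \<open>n \<ge> 3\<close>.\<close>

definition cycle_graph :: "nat \<Rightarrow> nat graph" where
  "cycle_graph n = \<lparr>verts = {..<n}, edges = {{i, Suc i mod n} | i. i < n}\<rparr>"

definition complete_bipartite_graph :: "nat \<Rightarrow> nat \<Rightarrow> nat graph" where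
  "complete_bipartite_graph m n =
     \<lparr>verts = {..<m + n}, edges = {{i, j} | i j. i < m \<and> m \<le> j \<and> j < m + n}\<rparr>"

end

theory Submission
  imports Defs "HOL-Library.FuncSet"
begin

text \<open>If some vertex has degree at least 3 and the graph is not a claw, a discharging argument shows
  that the vertices of degree at most 2 disappear under iteration; from then on the minimum degree
  tends to infinity. Once it is at least 4, an automorphism of the line graph permutes the stars (the
  large cliques), hence comes from an automorphism of the graph, so the order of the automorphism
  group stops growing. A nontrivial automorphism of the line graph, however, moves almost all edges at
  some vertex, so it preserves only a small fraction of all 2-colourings, and eventually these
  fractions sum to less than 1. The remaining graphs are paths, whose iterated line graphs become
  empty, and cycles of length at least 6, which are their own line graphs.\<close>

text \<open>The exceptions are genuine: \<open>C_3\<close>, \<open>C_4\<close>, \<open>C_5\<close>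
  are isomorphic to their own line graphs and have distinguishing number 3, and the line graph of
  the claw is \<open>C_3\<close>. The claw is also the only connected graph that has a vertex of
  degree at least 3 while its line graph has none. Two constants shape the rest. An edge uv has
  degree d(u) + d(v) - 2 in the line graph, and 2d - 2 > d holds only for d \<ge> 3; below minimum
  degree 3 growth is not automatic, and the potential \<open>defect\<close> has to measure the
  progress. Minimum degree 4 is the second threshold: three edges at a vertex and the three edges of
  a triangle form the same clique in the line graph, so only with four or more edges must a clique
  be part of a star.\<close>

section \<open>Stars, degrees and double counting\<close>

definition star :: "'a graph \<Rightarrow> 'a \<Rightarrow> 'a set set" where
  "star G v = {e \<in> edges G. v \<in> e}"

definition degree :: "'a graph \<Rightarrow> 'a \<Rightarrow> nat" where
  "degree G v = card (star G v)"

definition nbrs :: "'a graph \<Rightarrow> 'a \<Rightarrow> 'a set" where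
  "nbrs G v = {w. {v, w} \<in> edges G}"

lemma finite_edges: "finite_simple_graph G \<Longrightarrow> finite (edges G)"
  unfolding finite_simple_graph_def by (auto intro!: finite_subset[of "edges G" "Pow (verts G)"])

lemma finite_star: "finite_simple_graph G \<Longrightarrow> finite (star G v)"
  by (simp add: star_def finite_edges)

lemma edge_neq: "finite_simple_graph G \<Longrightarrow> {u, v} \<in> edges G \<Longrightarrow> u \<noteq> v"
  unfolding finite_simple_graph_def by fastforce

lemma edge_verts:
  "finite_simple_graph G \<Longrightarrow> {u, v} \<in> edges G \<Longrightarrow> u \<in> verts G \<and> v \<in> verts G"
  unfolding finite_simple_graph_def by fastforce

lemma edgeE:
  assumes "finite_simple_graph G" "e \<in> edges G" "u \<in> e"
  obtains v where "e = {u, v}" "u \<noteq> v" "u \<in> verts G" "v \<in> verts G"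
proof -
  have "card e = 2" "e \<subseteq> verts G" using assms by (auto simp: finite_simple_graph_def)
  with \<open>u \<in> e\<close> show ?thesis
    using that by (auto simp: card_2_iff)
qed

lemma edge_eqI:
  assumes "finite_simple_graph G" "e \<in> edges G" "u \<in> e" "v \<in> e" "u \<noteq> v"
  shows "e = {u, v}"
  using assms by (metis edgeE insertE singletonD)

lemma degree_eq_card_nbrs:
  assumes "finite_simple_graph G"
  shows "degree G v = card (nbrs G v)"
proof -
  have "star G v = (\<lambda>w. {v, w}) ` nbrs G v"
    by (auto simp: star_def nbrs_def elim: edgeE[OF assms])
  moreover have "inj_on (\<lambda>w. {v, w}) (nbrs G v)"
    by (auto simp: inj_on_def doubleton_eq_iff)
  ultimately show ?thesis by (simp add: degree_def card_image)
qed

text \<open>Both sides sum \<open>f v\<close> over all incidences (v, e). With \<open>f\<close>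
  constant 1 this is the handshake lemma; the discharging argument uses it with charges.\<close>

lemma sum_edges_ends:
  fixes f :: "'a \<Rightarrow> nat"
  assumes G: "finite_simple_graph G"
  shows "(\<Sum>e\<in>edges G. \<Sum>v\<in>e. f v) = (\<Sum>v\<in>verts G. degree G v * f v)"
proof -
  have fin: "finite (verts G)" using G by (simp add: finite_simple_graph_def)
  have "(\<Sum>e\<in>edges G. \<Sum>v\<in>e. f v) = (\<Sum>e\<in>edges G. \<Sum>v\<in>{v \<in> verts G. v \<in> e}. f v)"
    using G by (intro sum.cong) (auto simp: finite_simple_graph_def)
  also have "\<dots> = (\<Sum>v\<in>verts G. \<Sum>e\<in>{e \<in> edges G. v \<in> e}. f v)"
    using fin finite_edges[OF G] by (rule sum.swap_restrict[symmetric])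
  also have "\<dots> = (\<Sum>v\<in>verts G. degree G v * f v)"
    by (simp add: degree_def star_def)
  finally show ?thesis .
qed

text \<open>The form in which connectedness is exploited throughout: a property passed on to
  neighbours spreads from one vertex to all.\<close>

lemma connected_closed:
  assumes "connected_graph G" "u \<in> S" "u \<in> verts G" "v \<in> verts G"
    and closed: "\<And>x y. x \<in> S \<Longrightarrow> {x, y} \<in> edges G \<Longrightarrow> y \<in> S"
  shows "v \<in> S"
proof -
  have "(u, v) \<in> {(x, y). {x, y} \<in> edges G}\<^sup>*"
    using assms by (auto simp: connected_graph_def)
  then show ?thesis
    by (induction rule: rtrancl_induct) (use assms in auto)
qed

section \<open>Isomorphisms\<close>

lemma graph_isomorphism_bij: "graph_isomorphism \<phi> G H \<Longrightarrow> bij_betw \<phi> (verts G) (verts H)"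
  by (simp add: graph_isomorphism_def)

lemma graph_isomorphism_verts: "graph_isomorphism \<phi> G H \<Longrightarrow> u \<in> verts G \<Longrightarrow> \<phi> u \<in> verts H"
  by (meson bij_betwE graph_isomorphism_bij)

lemma graph_isomorphism_edge_iff:
  "graph_isomorphism \<phi> G H \<Longrightarrow> u \<in> verts G \<Longrightarrow> v \<in> verts G \<Longrightarrow>
    {\<phi> u, \<phi> v} \<in> edges H \<longleftrightarrow> {u, v} \<in> edges G"
  by (simp add: graph_isomorphism_def)

lemma graph_isomorphism_inv:
  assumes "graph_isomorphism \<phi> G H"
  shows "graph_isomorphism (inv_into (verts G) \<phi>) H G"
proof -
  have b: "bij_betw \<phi> (verts G) (verts H)"
    using assms by (simp add: graph_isomorphism_def)
  then have "bij_betw (inv_into (verts G) \<phi>) (verts H) (verts G)"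
    by (rule bij_betw_inv_into)
  moreover have "inv_into (verts G) \<phi> u \<in> verts G" "\<phi> (inv_into (verts G) \<phi> u) = u"
    if "u \<in> verts H" for u
    using that b by (auto simp: bij_betw_def f_inv_into_f inv_into_into)
  ultimately show ?thesis
    using assms by (simp add: graph_isomorphism_def)
qed

lemma graph_isomorphism_comp:
  assumes "graph_isomorphism \<phi> G H" "graph_isomorphism \<psi> H I"
  shows "graph_isomorphism (\<psi> \<circ> \<phi>) G I"
proof -
  have "\<phi> u \<in> verts H" if "u \<in> verts G" for u
    using assms(1) that by (auto simp: graph_isomorphism_def bij_betw_def)
  then show ?thesis
    using assms bij_betw_trans[of \<phi> "verts G" "verts H" \<psi> "verts I"]
    by (simp add: graph_isomorphism_def)
qed

lemma isomorphic_graphs_sym: "isomorphic_graphs G H \<Longrightarrow> isomorphic_graphs H G"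
  unfolding isomorphic_graphs_def by (elim exE, rule exI, rule graph_isomorphism_inv)

lemma isomorphic_graphs_trans:
  "isomorphic_graphs G H \<Longrightarrow> isomorphic_graphs H I \<Longrightarrow> isomorphic_graphs G I"
  unfolding isomorphic_graphs_def by (elim exE, rule exI, rule graph_isomorphism_comp)

lemma connected_graph_isomorphic:
  assumes G: "finite_simple_graph G" and con: "connected_graph G" and iso: "isomorphic_graphs G H"
  shows "connected_graph H"
proof -
  obtain \<phi> where \<phi>: "graph_isomorphism \<phi> G H"
    using iso unfolding isomorphic_graphs_def ..
  let ?R = "{(x, y). {x, y} \<in> edges H}"
  have walk: "(\<phi> u, \<phi> v) \<in> ?R\<^sup>*" if "u \<in> verts G" "v \<in> verts G" for u v
  proof -
    have "v \<in> {v. (\<phi> u, \<phi> v) \<in> ?R\<^sup>*}"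
    proof (rule connected_closed[OF con _ that])
      fix x y assume x: "x \<in> {v. (\<phi> u, \<phi> v) \<in> ?R\<^sup>*}" and xy: "{x, y} \<in> edges G"
      have "{\<phi> x, \<phi> y} \<in> edges H"
        using graph_isomorphism_edge_iff[OF \<phi>, of x y] edge_verts[OF G xy] xy by simp
      then have "(\<phi> x, \<phi> y) \<in> ?R" by simp
      moreover have "(\<phi> u, \<phi> x) \<in> ?R\<^sup>*" using x unfolding mem_Collect_eq .
      ultimately have "(\<phi> u, \<phi> y) \<in> ?R\<^sup>*" by (rule rtrancl_into_rtrancl[rotated])
      then show "y \<in> {v. (\<phi> u, \<phi> v) \<in> ?R\<^sup>*}" by (rule CollectI)
    qed simp
    then show ?thesis unfolding mem_Collect_eq .
  qed
  have im: "verts H = \<phi> ` verts G"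
    using graph_isomorphism_bij[OF \<phi>] by (simp add: bij_betw_def)
  show ?thesis
    unfolding connected_graph_def im by (intro ballI) (elim imageE, simp only: walk)
qed

lemma distinguishes_isomorphic:
  assumes \<phi>: "graph_isomorphism \<phi> G H" and f: "distinguishes f G"
  shows "distinguishes (f \<circ> inv_into (verts G) \<phi>) H"
  unfolding distinguishes_def
proof (intro allI impI, elim conjE bexE)
  fix \<psi> v assume \<psi>: "graph_automorphism \<psi> H" and v: "v \<in> verts H" "\<psi> v \<noteq> v"
  let ?i = "inv_into (verts G) \<phi>"
  have i: "?i u \<in> verts G" "\<phi> (?i u) = u" if "u \<in> verts H" for u
    using that graph_isomorphism_bij[OF \<phi>]
    by (auto simp: bij_betw_def f_inv_into_f inv_into_into)
  have \<psi>v: "\<psi> u \<in> verts H" if "u \<in> verts H" for u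
    using graph_isomorphism_verts[OF \<psi> that] .
  have \<phi>v: "\<phi> u \<in> verts H" if "u \<in> verts G" for u
    using graph_isomorphism_verts[OF \<phi> that] .
  have "graph_automorphism (?i \<circ> (\<psi> \<circ> \<phi>)) G"
    using \<phi> \<psi> by (intro graph_isomorphism_comp graph_isomorphism_inv)
  moreover have "(?i \<circ> (\<psi> \<circ> \<phi>)) (?i v) \<noteq> ?i v"
    using i[OF v(1)] i[OF \<psi>v[OF v(1)]] v(2) by auto
  ultimately have "\<exists>u\<in>verts G. f u \<noteq> f ((?i \<circ> (\<psi> \<circ> \<phi>)) u)"
    using f[unfolded distinguishes_def, rule_format, of "?i \<circ> (\<psi> \<circ> \<phi>)"] i(1)[OF v(1)] by blast
  then obtain u where u: "u \<in> verts G" "f u \<noteq> f (?i (\<psi> (\<phi> u)))" by auto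
  moreover have "?i (\<phi> u) = u"
    using graph_isomorphism_bij[OF \<phi>] u(1) by (simp add: bij_betw_def)
  ultimately show "\<exists>v\<in>verts H. (f \<circ> ?i) v \<noteq> (f \<circ> ?i) (\<psi> v)"
    using \<phi>v by (intro bexI[of _ "\<phi> u"]) auto
qed

lemma distinguishing_number_le:
  "f ` verts G \<subseteq> {1..k} \<Longrightarrow> distinguishes f G \<Longrightarrow> distinguishing_number G \<le> k"
  unfolding distinguishing_number_def by (rule Least_le) blast

section \<open>Degrees in line graphs\<close>

text \<open>Iteration relabels the vertices at each step, so the next graph is only isomorphic to
  the line graph. The locale describes one step up to isomorphism: \<open>H\<close> is any copy of
  the line graph of \<open>G\<close>, and \<open>l\<close> names the vertex of \<open>H\<close> that
  an edge becomes.\<close>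

locale line_iso =
  fixes G :: "'a graph" and H :: "'b graph" and l :: "'a set \<Rightarrow> 'b"
  assumes G: "finite_simple_graph G" and H: "finite_simple_graph H"
    and iso: "graph_isomorphism l (line_graph G) H"
begin

lemma bij: "bij_betw l (edges G) (verts H)"
  using iso by (simp add: graph_isomorphism_def line_graph_def)

lemma l_eq_iff: "e \<in> edges G \<Longrightarrow> f \<in> edges G \<Longrightarrow> l e = l f \<longleftrightarrow> e = f"
  using bij by (auto simp: bij_betw_def inj_on_def)

lemma vertsE:
  assumes "x \<in> verts H"
  obtains e where "e \<in> edges G" "x = l e"
  using assms bij by (auto simp: bij_betw_def)

lemma l_verts: "e \<in> edges G \<Longrightarrow> l e \<in> verts H"
  using bij by (auto simp: bij_betw_def)

lemma adj_iff:
  assumes "e \<in> edges G" "f \<in> edges G"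
  shows "{l e, l f} \<in> edges H \<longleftrightarrow> e \<noteq> f \<and> e \<inter> f \<noteq> {}"
proof -
  have "{l e, l f} \<in> edges H \<longleftrightarrow> {e, f} \<in> edges (line_graph G)"
    using iso assms by (simp add: graph_isomorphism_def line_graph_def)
  also have "\<dots> \<longleftrightarrow> e \<noteq> f \<and> e \<inter> f \<noteq> {}"
    using assms by (auto simp: line_graph_def doubleton_eq_iff)
  finally show ?thesis .
qed

text \<open>The neighbours of an edge are the other members of the two stars at its ends, and these
  stars share only the edge itself. It is counted twice in the sum of degrees and is no neighbour of
  itself, hence the 2.\<close>

lemma degree_line:
  assumes e: "{u, v} \<in> edges G"
  shows "degree H (l {u, v}) = degree G u + degree G v - 2"
proof -
  have uv: "u \<noteq> v" using edge_neq[OF G e] .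
  have fin: "finite (star G u)" "finite (star G v)" by (simp_all add: finite_star[OF G])
  let ?S = "(star G u \<union> star G v) - {{u, v}}"
  have "nbrs H (l {u, v}) = l ` ?S"
  proof (intro equalityI subsetI)
    fix x assume x: "x \<in> nbrs H (l {u, v})"
    then have "x \<in> verts H" using edge_verts[OF H] by (auto simp: nbrs_def)
    then obtain f where "f \<in> edges G" "x = l f" by (rule vertsE)
    with x show "x \<in> l ` ?S"
      using adj_iff[OF e] by (auto simp: nbrs_def star_def)
  next
    fix x assume "x \<in> l ` ?S"
    then show "x \<in> nbrs H (l {u, v})"
      using adj_iff[OF e] by (auto simp: nbrs_def star_def)
  qed
  moreover have "inj_on l ?S"
    using bij by (auto simp: bij_betw_def star_def intro: inj_on_subset)
  ultimately have "degree H (l {u, v}) = card ?S"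
    by (simp add: degree_eq_card_nbrs[OF H] card_image)
  also have "\<dots> = card (star G u \<union> star G v) - 1"
    using e by (subst card_Diff_singleton) (auto simp: star_def)
  also have "\<dots> = degree G u + degree G v - 2"
  proof -
    have "star G u \<inter> star G v = {{u, v}}"
      using e edge_eqI[OF G _ _ _ uv] unfolding star_def by blast
    with card_Un_Int[OF fin] show ?thesis by (simp add: degree_def)
  qed
  finally show ?thesis .
qed

lemma connected_line:
  assumes "connected_graph G"
  shows "connected_graph H"
proof -
  let ?R = "{(x, y). {x, y} \<in> edges H}"
  have "(l e, l f) \<in> ?R\<^sup>*" if e: "e \<in> edges G" and f: "f \<in> edges G" for e f
  proof -
    \<comment> \<open>The vertices all of whose edges are reachable from \<open>e\<close>. This set
      is closed under adjacency because the edge xy lies in both stars.\<close>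
    let ?S = "{v. \<forall>g\<in>star G v. (l e, l g) \<in> ?R\<^sup>*}"
    have step: "(l g, l h) \<in> ?R\<^sup>*" if "g \<in> edges G" "h \<in> edges G" "g \<inter> h \<noteq> {}" for g h
      using adj_iff[OF that(1,2)] that(3) by (cases "g = h") auto
    have "e \<noteq> {}" "f \<noteq> {}" "e \<subseteq> verts G" "f \<subseteq> verts G"
      using e f G by (auto simp: finite_simple_graph_def)
    then obtain u v where uv: "u \<in> e" "v \<in> f" "u \<in> verts G" "v \<in> verts G" by blast
    have "u \<in> ?S" using step[OF e] uv by (auto simp: star_def)
    then have "v \<in> ?S"
    proof (rule connected_closed[OF assms])
      fix x y assume x: "x \<in> ?S" and xy: "{x, y} \<in> edges G"
      show "y \<in> ?S"
      proof safe
        fix g assume "g \<in> star G y"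
        then have "(l {x, y}, l g) \<in> ?R\<^sup>*" using xy by (intro step) (auto simp: star_def)
        moreover have "(l e, l {x, y}) \<in> ?R\<^sup>*" using x xy by (auto simp: star_def)
        ultimately show "(l e, l g) \<in> ?R\<^sup>*" by (rule rtrancl_trans[rotated])
      qed
    qed (use uv in auto)
    then show ?thesis using f uv by (auto simp: star_def)
  qed
  then show ?thesis
    unfolding connected_graph_def by (auto elim!: vertsE)
qed

lemma card_verts_line: "card (verts H) = card (edges G)"
  using bij by (simp add: bij_betw_same_card)

end

section \<open>Growth of the minimum degree\<close>

text \<open>The bound 5 says that the edge has degree at least 3 in the line graph. Asking in addition for
  an end of degree 3 makes the property inherited by line graphs.\<close>

definition branching :: "'a graph \<Rightarrow> bool" where
  "branching G \<longleftrightarrow>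
     (\<exists>u v. {u, v} \<in> edges G \<and> degree G u \<ge> 3 \<and> degree G u + degree G v \<ge> 5)"

text \<open>Subtraction is truncated, so only vertices of degree at most 2 contribute, and the value
  0 means minimum degree at least 3.\<close>

definition defect :: "'a graph \<Rightarrow> nat" where
  "defect G = (\<Sum>v\<in>verts G. 3 - degree G v)"

lemma degree_pos:
  assumes "finite_simple_graph G" "{u, v} \<in> edges G"
  shows "degree G u \<ge> 1"
proof -
  have "{u, v} \<in> star G u" using assms by (simp add: star_def)
  then show ?thesis
    using finite_star[OF assms(1), of u] by (auto simp: degree_def Suc_le_eq card_gt_0_iff)
qed

context line_iso
begin

lemma branching_line:
  assumes "branching G"
  shows "branching H"
proof -
  obtain u v where uv: "{u, v} \<in> edges G" "degree G u \<ge> 3" "degree G u + degree G v \<ge> 5"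
    using assms by (auto simp: branching_def)
  have "card (star G u - {{u, v}}) = degree G u - 1"
    using uv by (subst card_Diff_singleton) (auto simp: star_def degree_def)
  then have "card (star G u - {{u, v}}) \<noteq> 0" using uv by linarith
  then have "star G u - {{u, v}} \<noteq> {}" by (metis card.empty)
  \<comment> \<open>A second edge at \<open>u\<close> supplies the partner: its other end has degree
    at least 1, so it has degree at least 3 + 1 - 2 in \<open>H\<close>, and the two degrees add up
    to at least 5.\<close>
  then obtain f where f: "f \<in> edges G" "u \<in> f" "f \<noteq> {u, v}" by (auto simp: star_def)
  obtain w where w: "f = {u, w}" using edgeE[OF G f(1,2)] .
  have "{l {u, v}, l {u, w}} \<in> edges H" using f uv w by (subst adj_iff) auto
  moreover have "degree H (l {u, v}) \<ge> 3" using uv by (simp add: degree_line)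
  moreover have "degree G w \<ge> 1" using f w degree_pos[OF G, of w u] by (simp add: insert_commute)
  then have "degree H (l {u, w}) \<ge> 2" using f w uv by (simp add: degree_line)
  ultimately show ?thesis
    unfolding branching_def by (intro exI[of _ "l {u, v}"] exI[of _ "l {u, w}"]) simp
qed

lemma min_degree_line:
  assumes "\<And>v. v \<in> verts G \<Longrightarrow> 3 + j \<le> degree G v" and x: "x \<in> verts H"
  shows "3 + Suc j \<le> degree H x"
proof -
  obtain e where e: "e \<in> edges G" "x = l e" using x by (rule vertsE)
  then obtain u v where uv: "e = {u, v}"
    using G by (auto simp: finite_simple_graph_def card_2_iff)
  with e edge_verts[OF G] have "3 + j \<le> degree G u" "3 + j \<le> degree G v"
    using assms by auto
  then show ?thesis using e uv by (simp add: degree_line)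
qed

text \<open>Discharging: an end of degree 1 sends 3 to its edge, an end of degree 2 sends 1.\<close>

lemma defect_line:
  assumes con: "connected_graph G" and br: "branching G"
  shows "defect H \<le> defect G - 1"
proof (cases "defect G = 0")
  case False
  \<comment> \<open>A vertex of degree d owns \<open>2 * (3 - d)\<close>, and an edge must receive
    twice its own deficiency in \<open>H\<close>; doubling keeps the shares integral. Degree 1
    spends 3 of 4, degree 2 spends both of its units. Ends of degrees (1,1), (1,2), (2,2) deliver
    exactly the required 6, 4, 2; ends of degrees (1,3) deliver 3 where 2 are required.\<close>
  define c :: "nat \<Rightarrow> nat" where "c d = (if d \<le> 1 then 3 else if d = 2 then 1 else 0)" for d
  have finV: "finite (verts G)" using G by (simp add: finite_simple_graph_def)
  have ge1: "degree G u \<ge> 1" "degree G v \<ge> 1" if "{u, v} \<in> edges G" for u v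
    using that degree_pos[OF G, of u v] degree_pos[OF G, of v u] by (simp_all add: insert_commute)
  have edge_le: "2 * (3 - degree H (l e)) \<le> (\<Sum>v\<in>e. c (degree G v))" if e: "e \<in> edges G" for e
  proof -
    obtain u v where uv: "e = {u, v}" "u \<noteq> v"
      using G e by (auto simp: finite_simple_graph_def card_2_iff)
    have "degree G u \<ge> 1" "degree G v \<ge> 1" using ge1[of u v] e uv by auto
    then have "2 * (3 - (degree G u + degree G v - 2)) \<le> c (degree G u) + c (degree G v)"
      unfolding c_def by (split if_split)+ arith
    then show ?thesis using e uv by (simp add: degree_line)
  qed
  have vert_le: "degree G v * c (degree G v) \<le> 2 * (3 - degree G v)" for v
    by (auto simp: c_def)
  have sumH: "defect H = (\<Sum>e\<in>edges G. 3 - degree H (l e))"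
    unfolding defect_def by (rule sum.reindex_bij_betw[OF bij, symmetric])
  \<comment> \<open>Strictness has two sources. A vertex of degree at most 1 does not spend all it
    owns. If there is none, connectedness gives an edge from degree 2 to degree at least 3; it
    receives 1 and requires nothing.\<close>
  have "2 * defect H < 2 * defect G"
  proof (cases "\<exists>v\<in>verts G. degree G v \<le> 1")
    case True
    then obtain v where v: "v \<in> verts G" "degree G v \<le> 1" by blast
    have "2 * defect H \<le> (\<Sum>e\<in>edges G. \<Sum>v\<in>e. c (degree G v))"
      unfolding sumH sum_distrib_left by (intro sum_mono edge_le)
    also have "\<dots> = (\<Sum>v\<in>verts G. degree G v * c (degree G v))"
      by (rule sum_edges_ends[OF G])
    also have "\<dots> < (\<Sum>v\<in>verts G. 2 * (3 - degree G v))"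
    proof (intro sum_strict_mono_ex1 finV ballI vert_le)
      show "\<exists>v\<in>verts G. degree G v * c (degree G v) < 2 * (3 - degree G v)"
        using v by (intro bexI[of _ v]) (auto simp: c_def le_Suc_eq)
    qed
    also have "\<dots> = 2 * defect G" by (simp add: defect_def sum_distrib_left)
    finally show ?thesis .
  next
    case no1: False
    obtain a where a: "a \<in> verts G" "degree G a \<ge> 3"
      using br edge_verts[OF G] by (auto simp: branching_def)
    obtain b where b: "b \<in> verts G" "degree G b < 3"
      using False finV by (auto simp: defect_def not_le)
    have "\<exists>x y. {x, y} \<in> edges G \<and> degree G x \<ge> 3 \<and> degree G y < 3"
    proof (rule ccontr)
      assume no: "\<not> ?thesis"
      have "b \<in> {x. degree G x \<ge> 3}"
      proof (rule connected_closed[OF con _ a(1) b(1)])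
        show "y \<in> {x. degree G x \<ge> 3}" if "x \<in> {x. degree G x \<ge> 3}" "{x, y} \<in> edges G" for x y
          using that no not_le by blast
      qed (use a in simp)
      then show False using b by simp
    qed
    then obtain x y where xy: "{x, y} \<in> edges G" "degree G x \<ge> 3" "degree G y < 3" by blast
    have dy: "degree G y = 2" using no1 edge_verts[OF G xy(1)] xy by force
    have "x \<noteq> y" using xy by auto
    have "2 * defect H < (\<Sum>e\<in>edges G. \<Sum>v\<in>e. c (degree G v))"
      unfolding sumH sum_distrib_left
    proof (intro sum_strict_mono_ex1 finite_edges[OF G] ballI edge_le)
      show "\<exists>e\<in>edges G. 2 * (3 - degree H (l e)) < (\<Sum>v\<in>e. c (degree G v))"
        using xy dy \<open>x \<noteq> y\<close> by (intro bexI[of _ "{x, y}"]) (auto simp: degree_line c_def)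
    qed
    also have "\<dots> = (\<Sum>v\<in>verts G. degree G v * c (degree G v))"
      by (rule sum_edges_ends[OF G])
    also have "\<dots> \<le> (\<Sum>v\<in>verts G. 2 * (3 - degree G v))"
      by (intro sum_mono vert_le)
    also have "\<dots> = 2 * defect G" by (simp add: defect_def sum_distrib_left)
    finally show ?thesis .
  qed
  then show ?thesis by simp
next
  case True
  have "3 - degree H x = 0" if x: "x \<in> verts H" for x
  proof -
    have "3 + 0 \<le> degree G v" if "v \<in> verts G" for v
      using True that G by (simp add: defect_def finite_simple_graph_def)
    from min_degree_line[OF this x] show ?thesis by simp
  qed
  then show ?thesis by (simp add: defect_def)
qed

end

section \<open>Automorphisms of line graphs\<close>

lemma graph_isomorphism_cong:
  assumes "graph_isomorphism \<phi> G H" "\<And>v. v \<in> verts G \<Longrightarrow> \<psi> v = \<phi> v"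
  shows "graph_isomorphism \<psi> G H"
proof -
  have "bij_betw \<psi> (verts G) (verts H)"
    using graph_isomorphism_bij[OF assms(1)] assms(2) by (simp cong: bij_betw_cong)
  then show ?thesis
    using assms by (simp add: graph_isomorphism_def)
qed

text \<open>Extensionality picks one function for each action on the vertices, so that the
  cardinality of this set is the order of the automorphism group.\<close>

definition automorphisms :: "'a graph \<Rightarrow> ('a \<Rightarrow> 'a) set" where
  "automorphisms G = {\<phi> \<in> extensional (verts G). graph_automorphism \<phi> G}"

lemma finite_automorphisms:
  assumes "finite_simple_graph G"
  shows "finite (automorphisms G)"
proof (rule finite_subset)
  show "automorphisms G \<subseteq> verts G \<rightarrow>\<^sub>E verts G"
  proof (intro subsetI PiE_I)
    fix \<phi> v assume \<phi>: "\<phi> \<in> automorphisms G"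
    then show "\<phi> v \<in> verts G" if "v \<in> verts G"
      using graph_isomorphism_verts[of \<phi> G G v] that unfolding automorphisms_def by blast
    show "\<phi> v = undefined" if "v \<notin> verts G"
      using \<phi> extensional_arb[of \<phi> "verts G" v] that unfolding automorphisms_def by blast
  qed
  show "finite (verts G \<rightarrow>\<^sub>E verts G)"
    using assms by (intro finite_PiE) (auto simp: finite_simple_graph_def)
qed

lemma restrict_automorphism:
  "graph_automorphism \<phi> G \<Longrightarrow> restrict \<phi> (verts G) \<in> automorphisms G"
  unfolding automorphisms_def by (auto intro: graph_isomorphism_cong)

text \<open>Three pairwise intersecting pairs may form a triangle; four may not.\<close>

lemma intersecting_pairs_common:
  assumes two: "\<And>e. e \<in> F \<Longrightarrow> card e = 2"
    and int: "\<And>e f. e \<in> F \<Longrightarrow> f \<in> F \<Longrightarrow> e \<inter> f \<noteq> {}"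
    and four: "card F \<ge> 4"
  shows "\<exists>w. \<forall>e\<in>F. w \<in> e"
proof (rule ccontr)
  assume no: "\<not> ?thesis"
  have "\<not> F \<subseteq> {e}" for e
    using four card_mono[of "{e}" F] by auto
  then obtain e f where ef: "e \<in> F" "f \<in> F" "e \<noteq> f" by blast
  obtain a where a: "a \<in> e" "a \<in> f" using int[OF ef(1,2)] by blast
  have other: "\<exists>y. y \<noteq> x \<and> e = {x, y}" if "e \<in> F" "x \<in> e" for e x
    using two[OF that(1)] that(2) by (auto simp: card_2_iff)
  obtain b where b: "b \<noteq> a" "e = {a, b}" using other[OF ef(1) a(1)] by blast
  obtain c where c: "c \<noteq> a" "f = {a, c}" using other[OF ef(2) a(2)] by blast
  have bc: "b \<noteq> c" using b c ef by blast
  have opp: "h = {b, c}" if "h \<in> F" "a \<notin> h" for h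
  proof -
    have "b \<in> h" "c \<in> h" using int[OF that(1) ef(1)] int[OF that(1) ef(2)] that(2) b c by auto
    then show ?thesis using other[OF that(1)] bc by blast
  qed
  \<comment> \<open>A pair \<open>g\<close> avoiding \<open>a\<close> must be {b, c}, and every pair
    containing \<open>a\<close> must then meet {b, c}; so all pairs lie in the triangle abc, which
    has only three.\<close>
  obtain g where g: "g \<in> F" "a \<notin> g" using no by blast
  have "h \<in> {{a, b}, {a, c}, {b, c}}" if h: "h \<in> F" for h
  proof (cases "a \<in> h")
    case True
    then obtain d where "h = {a, d}" using other[OF h] by blast
    moreover have "h \<inter> {b, c} \<noteq> {}" using int[OF h g(1)] opp[OF g] by simp
    ultimately show ?thesis using b(1) c(1) by auto
  qed (use opp[OF h] in simp)
  then have "card F \<le> card {{a, b}, {a, c}, {b, c}}"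
    by (intro card_mono) auto
  also have "\<dots> \<le> 3" by (simp add: card_insert_if)
  finally show False using four by simp
qed

lemma line_graph_adj_iff:
  "{e, f} \<in> edges (line_graph G) \<longleftrightarrow>
     e \<in> edges G \<and> f \<in> edges G \<and> e \<noteq> f \<and> e \<inter> f \<noteq> {}"
  unfolding line_graph_def by (auto simp: doubleton_eq_iff)

lemma verts_line_graph [simp]: "verts (line_graph G) = edges G"
  by (simp add: line_graph_def)

text \<open>Distinct vertices have at most one edge in common. This lets a star determine its
  centre.\<close>

lemma star_subset_imp_eq:
  assumes G: "finite_simple_graph G" and "degree G v \<ge> 2" and sub: "star G v \<subseteq> star G w"
  shows "v = w"
proof (rule ccontr)
  assume "v \<noteq> w"
  then have "star G v \<subseteq> {{v, w}}"
    using sub edge_eqI[OF G] unfolding star_def by blast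
  then have "card (star G v) \<le> 1"
    using card_mono[of "{{v, w}}"] by simp
  then show False using assms(2) by (simp add: degree_def)
qed

text \<open>The edges at \<open>v\<close> are pairwise adjacent in the line graph, so their images
  pairwise intersect; being at least four, they pass through one vertex.\<close>

lemma line_automorphism_star_subset:
  assumes G: "finite_simple_graph G" and p: "graph_automorphism p (line_graph G)"
    and deg: "degree G v \<ge> 4"
  shows "\<exists>w\<in>verts G. p ` star G v \<subseteq> star G w"
proof -
  have b: "bij_betw p (edges G) (edges G)" using graph_isomorphism_bij[OF p] by simp
  have pE: "p e \<in> edges G" if "e \<in> edges G" for e using bij_betwE[OF b] that by blast
  have sub: "star G v \<subseteq> edges G" by (auto simp: star_def)
  have two: "card e = 2" if "e \<in> p ` star G v" for e
    using that sub pE G by (auto simp: finite_simple_graph_def)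
  have "\<exists>w. \<forall>e\<in>p ` star G v. w \<in> e"
  proof (rule intersecting_pairs_common[OF two])
    fix e' f' assume "e' \<in> p ` star G v" "f' \<in> p ` star G v"
    then obtain e f where ef: "e \<in> star G v" "f \<in> star G v" "e' = p e" "f' = p f" by blast
    show "e' \<inter> f' \<noteq> {}"
    proof (cases "e = f")
      case True
      then show ?thesis using two[of e'] ef by auto
    next
      case False
      then have "{e, f} \<in> edges (line_graph G)"
        using ef unfolding line_graph_adj_iff by (auto simp: star_def)
      then have "{p e, p f} \<in> edges (line_graph G)"
        using graph_isomorphism_edge_iff[OF p, of e f] ef sub by auto
      then show ?thesis using ef unfolding line_graph_adj_iff by blast
    qed
  next
    have "inj_on p (star G v)" using b sub inj_on_subset by (auto simp: bij_betw_def)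
    then show "4 \<le> card (p ` star G v)" using deg by (simp add: card_image degree_def)
  qed
  then obtain w where w: "\<And>e. e \<in> p ` star G v \<Longrightarrow> w \<in> e" by blast
  have "star G v \<noteq> {}" using deg by (auto simp: degree_def)
  then obtain e where "e \<in> star G v" by blast
  then have "w \<in> verts G"
    using w[of "p e"] pE[of e] sub G by (auto simp: finite_simple_graph_def)
  moreover have "p ` star G v \<subseteq> star G w"
    using w sub pE by (auto simp: star_def)
  ultimately show ?thesis by blast
qed

text \<open>The inverse of \<open>p\<close> takes the star at \<open>w\<close> into a star again,
  and that star contains the one at \<open>v\<close>; hence it is the star at \<open>v\<close> and
  the inclusion is an equality.\<close>

lemma line_automorphism_star:
  assumes G: "finite_simple_graph G" and p: "graph_automorphism p (line_graph G)"
    and deg: "\<And>v. v \<in> verts G \<Longrightarrow> degree G v \<ge> 4" and v: "v \<in> verts G"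
  shows "\<exists>w\<in>verts G. p ` star G v = star G w"
proof -
  let ?q = "inv_into (edges G) p"
  have b: "bij_betw p (edges G) (edges G)" using graph_isomorphism_bij[OF p] by simp
  have q: "graph_automorphism ?q (line_graph G)" using graph_isomorphism_inv[OF p] by simp
  have sub: "star G v \<subseteq> edges G" for v by (auto simp: star_def)
  have qp: "?q ` p ` star G v = star G v" for v
    using inv_into_image_cancel[of p "edges G"] b sub by (simp add: bij_betw_def)
  have pq: "p ` ?q ` star G v = star G v" for v
    using image_inv_into_cancel[of p "edges G" "edges G"] b sub by (simp add: bij_betw_def)
  obtain w where w: "w \<in> verts G" "p ` star G v \<subseteq> star G w"
    using line_automorphism_star_subset[OF G p deg[OF v]] by blast
  obtain v' where v': "?q ` star G w \<subseteq> star G v'"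
    using line_automorphism_star_subset[OF G q deg[OF w(1)]] by blast
  have "star G v \<subseteq> star G v'"
    using image_mono[OF w(2), of ?q] v' unfolding qp by (rule subset_trans)
  then have "v = v'"
    using deg[OF v] by (intro star_subset_imp_eq[OF G]) simp_all
  then have "star G w \<subseteq> p ` star G v"
    using image_mono[OF v', of p] unfolding pq by simp
  then show ?thesis using w by blast
qed

text \<open>A case of Whitney's theorem on edge isomorphisms. The permutation of the stars defines
  \<phi> on their centres. Since uv is the only edge common to the stars at \<open>u\<close> and
  \<open>v\<close>, its image is the only edge common to the stars at \<open>\<phi> u\<close> and
  \<open>\<phi> v\<close>.\<close>

lemma line_automorphism_induced:
  assumes G: "finite_simple_graph G" and p: "graph_automorphism p (line_graph G)"
    and deg: "\<And>v. v \<in> verts G \<Longrightarrow> degree G v \<ge> 4"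
  shows "\<exists>\<phi>. graph_automorphism \<phi> G \<and> (\<forall>e\<in>edges G. p e = \<phi> ` e)"
proof -
  have b: "bij_betw p (edges G) (edges G)" using graph_isomorphism_bij[OF p] by simp
  then have inj: "inj_on p (edges G)" by (simp add: bij_betw_def)
  have sub: "star G v \<subseteq> edges G" for v by (auto simp: star_def)
  have "\<forall>v\<in>verts G. \<exists>w. w \<in> verts G \<and> p ` star G v = star G w"
    using line_automorphism_star[OF G p deg] by blast
  then obtain \<phi> where \<phi>:
    "\<And>v. v \<in> verts G \<Longrightarrow> \<phi> v \<in> verts G"
    "\<And>v. v \<in> verts G \<Longrightarrow> p ` star G v = star G (\<phi> v)"
    by metis
  have \<phi>inj: "inj_on \<phi> (verts G)"
  proof (rule inj_onI)
    fix u v assume uv: "u \<in> verts G" "v \<in> verts G" "\<phi> u = \<phi> v"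
    then have "p ` star G u = p ` star G v" using \<phi>(2) by simp
    then have "star G u = star G v" using inj_on_image_eq_iff[OF inj sub sub, of u v] by simp
    then show "u = v" using deg[OF uv(1)] by (intro star_subset_imp_eq[OF G]) simp_all
  qed
  have pe: "p {u, v} = {\<phi> u, \<phi> v}" "{\<phi> u, \<phi> v} \<in> edges G" if e: "{u, v} \<in> edges G" for u v
  proof -
    have uv: "u \<in> verts G" "v \<in> verts G" "u \<noteq> v"
      using edge_verts[OF G e] edge_neq[OF G e] by simp_all
    have "{u, v} \<in> star G u" "{u, v} \<in> star G v" using e by (simp_all add: star_def)
    then have "p {u, v} \<in> star G (\<phi> u)" "p {u, v} \<in> star G (\<phi> v)"
      using \<phi>(2)[OF uv(1)] \<phi>(2)[OF uv(2)] by blast+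
    moreover have "\<phi> u \<noteq> \<phi> v" using \<phi>inj uv by (simp add: inj_on_eq_iff)
    ultimately show "p {u, v} = {\<phi> u, \<phi> v}"
      by (intro edge_eqI[OF G]) (simp_all add: star_def)
    with \<open>p {u, v} \<in> star G (\<phi> u)\<close> show "{\<phi> u, \<phi> v} \<in> edges G"
      by (simp add: star_def)
  qed
  have refl_edge: "{u, v} \<in> edges G" if uv: "u \<in> verts G" "v \<in> verts G" "{\<phi> u, \<phi> v} \<in> edges G" for u v
  proof -
    have "{\<phi> u, \<phi> v} \<in> p ` star G u" "{\<phi> u, \<phi> v} \<in> p ` star G v"
      using \<phi>(2)[OF uv(1)] \<phi>(2)[OF uv(2)] uv(3) by (simp_all add: star_def)
    then obtain e f where ef: "e \<in> star G u" "f \<in> star G v" "p e = p f" by (metis imageE)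
    then have "e = f" using inj_onD[OF inj ef(3)] sub by blast
    moreover have "u \<noteq> v" using edge_neq[OF G uv(3)] by auto
    ultimately have "e = {u, v}" using ef by (intro edge_eqI[OF G]) (simp_all add: star_def)
    then show ?thesis using ef(1) by (simp add: star_def)
  qed
  have "\<phi> ` verts G = verts G"
    using G \<phi>(1) \<phi>inj by (intro endo_inj_surj) (auto simp: finite_simple_graph_def)
  then have "graph_automorphism \<phi> G"
    unfolding graph_isomorphism_def bij_betw_def using \<phi>inj pe(2) refl_edge by blast
  moreover have "p e = \<phi> ` e" if "e \<in> edges G" for e
  proof -
    obtain u v where "e = {u, v}"
      using G \<open>e \<in> edges G\<close> by (auto simp: finite_simple_graph_def card_2_iff)
    then show ?thesis using pe(1) that by simp
  qed
  ultimately show ?thesis by blast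
qed

section \<open>Automorphisms of the line graph pulled back to the graph\<close>

context line_iso
begin

lemma automorphism_induced:
  assumes \<psi>: "graph_automorphism \<psi> H"
    and deg: "\<And>v. v \<in> verts G \<Longrightarrow> degree G v \<ge> 4"
  shows "\<exists>\<phi>. graph_automorphism \<phi> G \<and> (\<forall>e\<in>edges G. \<phi> ` e \<in> edges G \<and> \<psi> (l e) = l (\<phi> ` e))"
proof -
  let ?p = "inv_into (edges G) l \<circ> (\<psi> \<circ> l)"
  have p: "graph_automorphism ?p (line_graph G)"
    using graph_isomorphism_comp[OF graph_isomorphism_comp[OF iso \<psi>] graph_isomorphism_inv[OF iso]]
    by simp
  obtain \<phi> where \<phi>: "graph_automorphism \<phi> G" "\<And>e. e \<in> edges G \<Longrightarrow> ?p e = \<phi> ` e"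
    using line_automorphism_induced[OF G p deg] by auto
  have "\<phi> ` e \<in> edges G \<and> \<psi> (l e) = l (\<phi> ` e)" if e: "e \<in> edges G" for e
  proof -
    have "\<psi> (l e) \<in> l ` edges G"
      using graph_isomorphism_verts[OF \<psi> l_verts[OF e]] bij by (simp add: bij_betw_def)
    then show ?thesis
      using \<phi>(2)[OF e] f_inv_into_f[of "\<psi> (l e)" l "edges G"] inv_into_into[of "\<psi> (l e)" l "edges G"]
      by simp
  qed
  with \<phi>(1) show ?thesis by blast
qed

text \<open>Sending \<phi> to its action on edges, carried over to \<open>H\<close> by
  \<open>l\<close>, reaches every automorphism of \<open>H\<close>.\<close>

lemma card_automorphisms_line:
  assumes deg: "\<And>v. v \<in> verts G \<Longrightarrow> degree G v \<ge> 4"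
  shows "card (automorphisms H) \<le> card (automorphisms G)"
proof (rule surj_card_le[OF finite_automorphisms[OF G]])
  let ?F = "\<lambda>\<phi>. restrict (\<lambda>x. l (\<phi> ` inv_into (edges G) l x)) (verts H)"
  show "automorphisms H \<subseteq> ?F ` automorphisms G"
  proof
    fix \<psi> assume \<psi>: "\<psi> \<in> automorphisms H"
    then have "graph_automorphism \<psi> H" by (simp add: automorphisms_def)
    from automorphism_induced[OF this deg] obtain \<phi>
      where \<phi>: "graph_automorphism \<phi> G" "\<And>e. e \<in> edges G \<Longrightarrow> \<psi> (l e) = l (\<phi> ` e)"
      by auto
    have "\<psi> = ?F (restrict \<phi> (verts G))"
    proof (rule extensionalityI)
      show "\<psi> \<in> extensional (verts H)" using \<psi> by (simp add: automorphisms_def)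
      fix x assume x: "x \<in> verts H"
      then obtain e where e: "e \<in> edges G" "x = l e" by (rule vertsE)
      have "restrict \<phi> (verts G) ` e = \<phi> ` e"
        using e G by (intro image_cong) (auto simp: finite_simple_graph_def)
      moreover have "inv_into (edges G) l (l e) = e"
        using bij e by (simp add: bij_betw_def)
      ultimately show "\<psi> x = ?F (restrict \<phi> (verts G)) x"
        using \<phi>(2)[OF e(1)] e(2) x by simp
    qed simp
    then show "\<psi> \<in> ?F ` automorphisms G"
      using restrict_automorphism[OF \<phi>(1)] by blast
  qed
qed

text \<open>If the underlying automorphism moves \<open>v\<close> to \<open>v'\<close>, then it moves every edge at \<open>v\<close>
  other than \<open>vv'\<close> to an edge that is not at \<open>v\<close>.\<close>

lemma automorphism_moves:
  assumes deg: "\<And>v. v \<in> verts G \<Longrightarrow> degree G v \<ge> 4 \<and> degree G v \<ge> Suc m"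
    and \<psi>: "graph_automorphism \<psi> H" and x: "x \<in> verts H" "\<psi> x \<noteq> x"
  shows "\<exists>T\<subseteq>verts H. m \<le> card T \<and> T \<inter> \<psi> ` T = {}"
proof -
  obtain \<phi> where \<phi>: "graph_automorphism \<phi> G" "\<And>e. e \<in> edges G \<Longrightarrow> \<phi> ` e \<in> edges G"
    "\<And>e. e \<in> edges G \<Longrightarrow> \<psi> (l e) = l (\<phi> ` e)"
    using automorphism_induced[OF \<psi>] deg by auto
  obtain e where e: "e \<in> edges G" "x = l e" using x(1) by (rule vertsE)
  have "\<exists>v\<in>e. \<phi> v \<noteq> v"
  proof (rule ccontr)
    assume "\<not> ?thesis"
    then have "\<phi> ` e = e" by force
    then show False using \<phi>(3)[OF e(1)] e x by simp
  qed
  then obtain v where v: "v \<in> e" "\<phi> v \<noteq> v" by blast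
  then have "v \<in> verts G" using e G by (auto simp: finite_simple_graph_def)
  \<comment> \<open>Deleting the possible edge between \<open>v\<close> and its image costs at most
    one element, which the \<open>Suc\<close> in the degree bound pays for.\<close>
  let ?S = "star G v - {{v, \<phi> v}}"
  have sub: "?S \<subseteq> edges G" by (auto simp: star_def)
  have "card (star G v) - 1 \<le> card ?S"
    using diff_card_le_card_Diff[of "{{v, \<phi> v}}" "star G v"] by simp
  moreover have "card (l ` ?S) = card ?S"
    using bij inj_on_subset[OF _ sub] by (intro card_image) (auto simp: bij_betw_def)
  ultimately have "m \<le> card (l ` ?S)"
    using deg[OF \<open>v \<in> verts G\<close>] unfolding degree_def by linarith
  moreover have "l ` ?S \<subseteq> verts H" using l_verts sub by blast
  moreover have "l ` ?S \<inter> \<psi> ` l ` ?S = {}"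
  proof -
    have False if "f \<in> ?S" "g \<in> ?S" "l f = \<psi> (l g)" for f g
    proof -
      have fg: "f \<in> edges G" "g \<in> edges G" using that sub by blast+
      then have "f = \<phi> ` g" using that(3) \<phi>(2,3)[OF fg(2)] l_eq_iff by simp
      then have "\<phi> v \<in> f" using that(2) by (auto simp: star_def)
      moreover have "v \<in> f" using that(1) by (auto simp: star_def)
      ultimately have "f = {v, \<phi> v}" using edge_eqI[OF G fg(1)] v(2) by metis
      then show False using that(1) by simp
    qed
    then show ?thesis by blast
  qed
  ultimately show ?thesis by blast
qed

end

section \<open>Two-colourings\<close>

text \<open>A colouring is the set \<open>S\<close> of vertices of one colour. If \<phi> preserves
  it, the colour of each v in T is that of \<phi> v, which lies outside T; so the colouring is
  determined by its restriction to \<open>V - T\<close>. With N maps and n vertices at most N *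
  2^(n-N) colourings are preserved by some map, fewer than 2^n because N < 2^N.\<close>

lemma two_colouring:
  assumes V: "finite V" and \<Phi>: "finite \<Phi>"
    and move: "\<And>\<phi>. \<phi> \<in> \<Phi> \<Longrightarrow> \<exists>T\<subseteq>V. card \<Phi> \<le> card T \<and> T \<inter> \<phi> ` T = {} \<and> \<phi> ` T \<subseteq> V"
  shows "\<exists>S. \<forall>\<phi>\<in>\<Phi>. \<exists>v\<in>V. v \<in> S \<longleftrightarrow> \<phi> v \<notin> S"
proof (cases "\<Phi> = {}")
  case False
  define Bad where "Bad \<phi> = {S. S \<subseteq> V \<and> (\<forall>v\<in>V. v \<in> S \<longleftrightarrow> \<phi> v \<in> S)}" for \<phi>
  let ?N = "card \<Phi>" and ?n = "card V"
  have bad: "card (Bad \<phi>) \<le> 2 ^ (?n - ?N)" if \<phi>: "\<phi> \<in> \<Phi>" for \<phi>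
  proof -
    obtain T where T: "T \<subseteq> V" "?N \<le> card T" "T \<inter> \<phi> ` T = {}" "\<phi> ` T \<subseteq> V"
      using move[OF \<phi>] by blast
    have inj: "inj_on (\<lambda>S. S - T) (Bad \<phi>)"
    proof (rule inj_onI)
      fix S S' assume S: "S \<in> Bad \<phi>" "S' \<in> Bad \<phi>" "S - T = S' - T"
      have "v \<in> S \<longleftrightarrow> v \<in> S'" for v
      proof (cases "v \<in> T")
        case True
        then have "\<phi> v \<notin> T" using T(3) by blast
        then have "\<phi> v \<in> S \<longleftrightarrow> \<phi> v \<in> S'" using S(3) by blast
        then show ?thesis using S(1,2) True T(1) unfolding Bad_def by blast
      qed (use S(3) in blast)
      then show "S = S'" by blast
    qed
    have "card (Bad \<phi>) = card ((\<lambda>S. S - T) ` Bad \<phi>)" using inj by (simp add: card_image)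
    also have "\<dots> \<le> card (Pow (V - T))"
      using V by (intro card_mono) (auto simp: Bad_def)
    also have "\<dots> = 2 ^ (?n - card T)"
      using V T(1) by (simp add: card_Pow card_Diff_subset finite_subset)
    also have "\<dots> \<le> 2 ^ (?n - ?N)" using T(2) by (intro power_increasing) auto
    finally show ?thesis .
  qed
  \<comment> \<open>Guards the truncated exponent: 2^N * 2^(n-N) = 2^n requires N \<le> n.\<close>
  have Nn: "?N \<le> ?n"
  proof -
    obtain \<phi> where \<phi>: "\<phi> \<in> \<Phi>" using False by blast
    obtain T where "T \<subseteq> V" "?N \<le> card T" using move[OF \<phi>] by blast
    then show ?thesis using card_mono[OF V \<open>T \<subseteq> V\<close>] by simp
  qed
  have "card (\<Union>\<phi>\<in>\<Phi>. Bad \<phi>) \<le> (\<Sum>\<phi>\<in>\<Phi>. card (Bad \<phi>))"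
    using \<Phi> by (rule card_UN_le)
  also have "\<dots> \<le> ?N * 2 ^ (?n - ?N)"
    using sum_bounded_above[of \<Phi> "\<lambda>\<phi>. card (Bad \<phi>)" "2 ^ (?n - ?N)"] bad by simp
  also have "\<dots> < 2 ^ ?N * 2 ^ (?n - ?N)" by simp
  also have "\<dots> = 2 ^ ?n" using Nn by (simp flip: power_add)
  also have "\<dots> = card (Pow V)" using V by (simp add: card_Pow)
  finally have "card (\<Union>\<phi>\<in>\<Phi>. Bad \<phi>) < card (Pow V)" .
  moreover have "finite (\<Union>\<phi>\<in>\<Phi>. Bad \<phi>)"
    using V by (auto simp: Bad_def intro: finite_subset[where B = "Pow V"])
  ultimately have "\<not> Pow V \<subseteq> (\<Union>\<phi>\<in>\<Phi>. Bad \<phi>)"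
    using card_mono leD by metis
  then obtain S where "S \<subseteq> V" "\<forall>\<phi>\<in>\<Phi>. S \<notin> Bad \<phi>" by blast
  then have "\<forall>\<phi>\<in>\<Phi>. \<exists>v\<in>V. v \<in> S \<longleftrightarrow> \<phi> v \<notin> S" by (auto simp: Bad_def)
  then show ?thesis ..
qed simp

lemma (in line_iso) distinguishing_number_line_le_2:
  assumes deg: "\<And>v. v \<in> verts G \<Longrightarrow> degree G v \<ge> 4 \<and> degree G v \<ge> Suc (card (automorphisms H))"
  shows "distinguishing_number H \<le> 2"
proof -
  define \<Phi> where "\<Phi> = {\<phi> \<in> automorphisms H. \<exists>v\<in>verts H. \<phi> v \<noteq> v}"
  have fin: "finite (automorphisms H)" by (rule finite_automorphisms[OF H])
  have sub: "\<Phi> \<subseteq> automorphisms H" by (auto simp: \<Phi>_def)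
  have "\<exists>S. \<forall>\<phi>\<in>\<Phi>. \<exists>v\<in>verts H. v \<in> S \<longleftrightarrow> \<phi> v \<notin> S"
  proof (rule two_colouring)
    fix \<phi> assume "\<phi> \<in> \<Phi>"
    then obtain x where \<phi>: "graph_automorphism \<phi> H" and x: "x \<in> verts H" "\<phi> x \<noteq> x"
      by (auto simp: \<Phi>_def automorphisms_def)
    obtain T where T: "T \<subseteq> verts H" "card (automorphisms H) \<le> card T" "T \<inter> \<phi> ` T = {}"
      using automorphism_moves[OF deg \<phi> x] by auto
    have "\<phi> ` T \<subseteq> verts H" using T(1) graph_isomorphism_verts[OF \<phi>] by auto
    moreover have "card \<Phi> \<le> card T" using card_mono[OF fin sub] T(2) by simp
    ultimately show "\<exists>T\<subseteq>verts H. card \<Phi> \<le> card T \<and> T \<inter> \<phi> ` T = {} \<and> \<phi> ` T \<subseteq> verts H"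
      using T by auto
  qed (use H finite_subset[OF sub fin] in \<open>simp_all add: finite_simple_graph_def\<close>)
  then obtain S where S: "\<forall>\<phi>\<in>\<Phi>. \<exists>v\<in>verts H. v \<in> S \<longleftrightarrow> \<phi> v \<notin> S" ..
  have "distinguishes (\<lambda>v. if v \<in> S then 1 else 2) H"
    unfolding distinguishes_def
  proof (intro allI impI, elim conjE bexE)
    fix \<phi> v assume \<phi>: "graph_automorphism \<phi> H" and "v \<in> verts H" "\<phi> v \<noteq> v"
    then have "restrict \<phi> (verts H) \<in> \<Phi>"
      using restrict_automorphism[OF \<phi>] by (auto simp: \<Phi>_def)
    from bspec[OF S this] obtain w where "w \<in> verts H" "w \<in> S \<longleftrightarrow> \<phi> w \<notin> S" by auto
    then show "\<exists>v\<in>verts H. (if v \<in> S then 1 else 2) \<noteq> (if \<phi> v \<in> S then 1 else (2::nat))"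
      by (intro bexI[of _ w]) auto
  qed
  then show ?thesis by (rule distinguishing_number_le[rotated]) auto
qed

section \<open>Paths and cycles\<close>

lemma (in line_iso) path_line:
  assumes con: "connected_graph G" and deg: "\<And>v. v \<in> verts G \<Longrightarrow> degree G v \<le> 2"
    and small: "verts G = {} \<or> (\<exists>v\<in>verts G. degree G v \<le> 1)"
  shows "\<And>x. x \<in> verts H \<Longrightarrow> degree H x \<le> 2"
    and "verts H = {} \<or> (\<exists>x\<in>verts H. degree H x \<le> 1)"
    and "card (verts H) \<le> card (verts G) - 1"
proof -
  have degH: "degree H (l {u, v}) \<le> degree G u" if "{u, v} \<in> edges G" for u v
    using degree_line[OF that] deg[of v] edge_verts[OF G that] by simp
  fix x assume "x \<in> verts H"
  then obtain e where e: "e \<in> edges G" "x = l e" by (rule vertsE)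
  moreover obtain u v where "e = {u, v}"
    using G e(1) by (auto simp: finite_simple_graph_def card_2_iff)
  ultimately show "degree H x \<le> 2"
    using degH[of u v] deg[of u] edge_verts[OF G, of u v] by simp
next
  have empty: "verts H = {}" if "verts G = {}"
  proof -
    have "edges G = {}" using G that by (fastforce simp: finite_simple_graph_def)
    then show ?thesis using bij by (simp add: bij_betw_def)
  qed
  show "verts H = {} \<or> (\<exists>x\<in>verts H. degree H x \<le> 1)"
  proof (cases "verts G = {}")
    case False
    then obtain v where v: "v \<in> verts G" "degree G v \<le> 1" using small by blast
    show ?thesis
    proof (cases "star G v = {}")
      case True
      \<comment> \<open>An isolated vertex of a connected graph is its only vertex, so no edge is
        left to become a vertex of \<open>H\<close>.\<close>
      have single: "w \<in> {v}" if w: "w \<in> verts G" for w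
      proof (rule connected_closed[OF con _ v(1) w])
        show "y \<in> {v}" if "x \<in> {v}" "{x, y} \<in> edges G" for x y
          using that True by (auto simp: star_def)
      qed simp
      have "edges G = {}"
      proof (rule equals0I)
        fix e assume "e \<in> edges G"
        then have "e \<subseteq> {v}" "card e = 2"
          using single G by (auto simp: finite_simple_graph_def)
        then show False using card_mono[of "{v}" e] by simp
      qed
      then show ?thesis using bij by (simp add: bij_betw_def)
    next
      case False
      then obtain e where e: "e \<in> edges G" "v \<in> e" by (auto simp: star_def)
      obtain w where w: "e = {v, w}" "w \<in> verts G" using edgeE[OF G e] by blast
      have "degree H (l e) \<le> 1"
        using degree_line[of v w] e(1) w v(2) deg[OF w(2)] by simp
      then show ?thesis using l_verts[OF e(1)] by blast
    qed
  qed (use empty in simp)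
  show "card (verts H) \<le> card (verts G) - 1"
  proof (cases "verts G = {}")
    case False
    then obtain v where v: "v \<in> verts G" "degree G v \<le> 1" using small by blast
    have "2 * card (edges G) = (\<Sum>e\<in>edges G. \<Sum>v\<in>e. 1)"
      using G by (simp add: finite_simple_graph_def)
    also have "\<dots> = (\<Sum>v\<in>verts G. degree G v)"
      using sum_edges_ends[OF G, of "\<lambda>_. 1"] by simp
    also have "\<dots> < (\<Sum>v\<in>verts G. 2)"
    proof (rule sum_strict_mono_ex1)
      show "\<exists>v\<in>verts G. degree G v < 2" using v by (intro bexI[of _ v]) auto
    qed (use G deg in \<open>simp_all add: finite_simple_graph_def\<close>)
    finally show ?thesis unfolding card_verts_line by simp
  qed (use empty in simp)
qed

lemma (in line_iso) two_regular_line: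
  assumes deg: "\<And>v. v \<in> verts G \<Longrightarrow> degree G v = 2"
  shows "\<And>x. x \<in> verts H \<Longrightarrow> degree H x = 2" and "card (verts H) = card (verts G)"
proof -
  fix x assume "x \<in> verts H"
  then obtain e where e: "e \<in> edges G" "x = l e" by (rule vertsE)
  moreover obtain u v where "e = {u, v}"
    using G e(1) by (auto simp: finite_simple_graph_def card_2_iff)
  ultimately show "degree H x = 2"
    using degree_line[of u v] deg edge_verts[OF G, of u v] by simp
next
  have "2 * card (edges G) = (\<Sum>e\<in>edges G. \<Sum>v\<in>e. 1)"
    using G by (simp add: finite_simple_graph_def)
  also have "\<dots> = (\<Sum>v\<in>verts G. degree G v)"
    using sum_edges_ends[OF G, of "\<lambda>_. 1"] by simp
  also have "\<dots> = 2 * card (verts G)" using deg by simp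
  finally show "card (verts H) = card (verts G)" unfolding card_verts_line by simp
qed

section \<open>Cycles and connected 2-regular graphs\<close>

text \<open>Eliminates \<open>mod\<close>, so that adjacency questions in cycles become linear
  arithmetic.\<close>

lemma cycle_graph_adj_iff:
  assumes "n \<ge> 3" "i < n" "j < n"
  shows "{i, j} \<in> edges (cycle_graph n) \<longleftrightarrow>
    j = Suc i \<or> i = Suc j \<or> (i = 0 \<and> j = n - 1) \<or> (j = 0 \<and> i = n - 1)"
proof -
  have s: "j = Suc i mod n \<longleftrightarrow> j = Suc i \<or> (j = 0 \<and> i = n - 1)" if "i < n" "j < n" for i j
    using that assms(1) by (cases "Suc i = n") auto
  have "{i, j} \<in> edges (cycle_graph n) \<longleftrightarrow> j = Suc i mod n \<or> i = Suc j mod n"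
    using assms by (auto simp: cycle_graph_def doubleton_eq_iff)
  then show ?thesis using s[OF assms(2,3)] s[OF assms(3,2)] by argo
qed

text \<open>The colour class \<open>{0, 1, 3}\<close> induces an edge and an isolated vertex, and only one end of
  the edge has a common neighbour with the isolated vertex when \<open>n \<ge> 6\<close>.\<close>

lemma distinguishes_cycle_graph:
  assumes n: "n \<ge> 6"
  shows "distinguishes (\<lambda>i. if i \<in> {0, 1, 3} then 2 else 1) (cycle_graph n)"
  unfolding distinguishes_def
proof (intro allI impI, elim conjE bexE, rule ccontr)
  let ?C = "cycle_graph n" and ?f = "\<lambda>i::nat. if i \<in> {0, 1, 3} then 2 else (1::nat)"
  fix \<phi> v assume \<phi>: "graph_automorphism \<phi> ?C" and v: "v \<in> verts ?C" "\<phi> v \<noteq> v"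
    and "\<not> (\<exists>v\<in>verts ?C. ?f v \<noteq> ?f (\<phi> v))"
  then have f: "?f (\<phi> i) = ?f i" if "i < n" for i
    using that by (auto simp: cycle_graph_def)
  have lt: "\<phi> i < n" if "i < n" for i
    using graph_isomorphism_verts[OF \<phi>, of i] that by (simp add: cycle_graph_def)
  have inj: "\<phi> i = \<phi> j \<longleftrightarrow> i = j" if "i < n" "j < n" for i j
    using graph_isomorphism_bij[OF \<phi>] that by (auto simp: bij_betw_def inj_on_def cycle_graph_def)
  define adj where "adj i j \<longleftrightarrow>
    j = Suc i \<or> i = Suc j \<or> (i = 0 \<and> j = n - 1) \<or> (j = 0 \<and> i = n - 1)" for i j
  have adj: "adj (\<phi> i) (\<phi> j)" if "i < n" "j < n" "adj i j" for i j
  proof -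
    have "{\<phi> i, \<phi> j} \<in> edges ?C"
      using graph_isomorphism_edge_iff[OF \<phi>, of i j] that cycle_graph_adj_iff[of n i j] n
      unfolding adj_def by (simp add: cycle_graph_def)
    then show ?thesis
      using cycle_graph_adj_iff[of n "\<phi> i" "\<phi> j"] lt[OF that(1)] lt[OF that(2)] n
      unfolding adj_def by simp
  qed
  have marked: "\<phi> i \<in> {0, 1, 3}" if "i \<in> {0, 1, 3}" for i
  proof (rule ccontr)
    assume "\<phi> i \<notin> {0, 1, 3}"
    moreover have "i < n" using that n by auto
    ultimately show False using f[of i] that by (simp split: if_splits)
  qed
  have ne: "\<phi> 0 \<noteq> \<phi> 1" "\<phi> 0 \<noteq> \<phi> 3" "\<phi> 1 \<noteq> \<phi> 3" using inj n by simp_all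
  have adj01: "adj (\<phi> 0) (\<phi> 1)" using adj[of 0 1] n by (simp add: adj_def)
  have adj12: "adj (\<phi> 1) (\<phi> 2)" using adj[of 1 2] n by (simp add: adj_def)
  have adj23: "adj (\<phi> 2) (\<phi> 3)" using adj[of 2 3] n by (simp add: adj_def)
  have c: "\<phi> 0 \<in> {0, 1, 3}" "\<phi> 1 \<in> {0, 1, 3}" "\<phi> 3 \<in> {0, 1, 3}" using marked by simp_all
  have edge: "(\<phi> 0 = 0 \<and> \<phi> 1 = 1) \<or> (\<phi> 0 = 1 \<and> \<phi> 1 = 0)"
    using c(1,2) ne(1) adj01 n unfolding adj_def by auto
  then have \<phi>3: "\<phi> 3 = 3" using c(3) ne(2,3) by auto
  \<comment> \<open>The image of 2 is a neighbour of 3. Neither 2 nor 4 is adjacent to 0; for 4 this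
    would need n = 5. So 1 cannot go to 0.\<close>
  then have "\<phi> 2 = 2 \<or> \<phi> 2 = 4" using adj23 n unfolding adj_def by auto
  then have "\<phi> 1 \<noteq> 0" using adj12 n unfolding adj_def by auto
  then have \<phi>01: "\<phi> 0 = 0" "\<phi> 1 = 1" using edge by auto
  \<comment> \<open>With 0 and 1 fixed the rest follows along the cycle: the image of k + 2 is a
    neighbour of k + 1 other than k.\<close>
  have "i < n \<longrightarrow> \<phi> i = i" for i
  proof (induction i rule: less_induct)
    case (less i)
    show ?case
    proof (cases "i \<le> 1")
      case True
      then show ?thesis using \<phi>01 by (auto simp: le_Suc_eq)
    next
      case False
      then obtain k where k: "i = Suc (Suc k)" by (metis One_nat_def Suc_le_mono le0 not0_implies_Suc)
      show ?thesis
      proof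
        assume i: "i < n"
        have "\<phi> k = k" "\<phi> (Suc k) = Suc k" using less[of k] less[of "Suc k"] i k by simp_all
        moreover have "adj (\<phi> (Suc k)) (\<phi> i)" using adj[of "Suc k" i] i k by (simp add: adj_def)
        moreover have "\<phi> i \<noteq> \<phi> k" using inj[of i k] i k by simp
        ultimately show "\<phi> i = i" using i k unfolding adj_def by auto
      qed
    qed
  qed
  then show False using v by (simp add: cycle_graph_def)
qed

text \<open>Follow an infinite walk that never turns back up to its first repeated vertex. Degree 2
  makes the walk close up at its start, and connectedness makes the closed walk cover all
  vertices.\<close>

lemma two_regular_isomorphic_cycle_graph:
  assumes G: "finite_simple_graph G" and con: "connected_graph G" and ne: "verts G \<noteq> {}"
    and deg: "\<And>v. v \<in> verts G \<Longrightarrow> degree G v = 2"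
  shows "card (verts G) \<ge> 3" and "isomorphic_graphs (cycle_graph (card (verts G))) G"
proof -
  have card_nbrs: "card (nbrs G v) = 2" if "v \<in> verts G" for v
    using deg[OF that] degree_eq_card_nbrs[OF G] by simp
  have nbrs_eq: "nbrs G v = {a, b}"
    if "v \<in> verts G" "{v, a} \<in> edges G" "{v, b} \<in> edges G" "a \<noteq> b" for v a b
  proof (rule card_subset_eq[symmetric])
    show "finite (nbrs G v)" using card_nbrs[OF that(1)] card_ge_0_finite by force
    show "{a, b} \<subseteq> nbrs G v" using that by (simp add: nbrs_def)
    show "card {a, b} = card (nbrs G v)" using card_nbrs[OF that(1)] that(4) by simp
  qed
  have ex_other: "\<exists>w. {v, w} \<in> edges G \<and> w \<noteq> a" if "v \<in> verts G" for v a
  proof -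
    have "\<not> nbrs G v \<subseteq> {a}" using card_nbrs[OF that] card_mono[of "{a}" "nbrs G v"] by auto
    then show ?thesis by (auto simp: nbrs_def)
  qed
  \<comment> \<open>The state is a pair of consecutive vertices, because the next vertex depends on
    the last two.\<close>
  have "\<exists>s. \<forall>i. (case s i of (p, q) \<Rightarrow> {p, q} \<in> edges G) \<and>
      fst (s (Suc i)) = snd (s i) \<and> snd (s (Suc i)) \<noteq> fst (s i)"
  proof (rule dependent_nat_choice)
    obtain v where "v \<in> verts G" using ne by blast
    then obtain w where "{v, w} \<in> edges G" using ex_other[of v v] by blast
    then show "\<exists>s. case s of (p, q) \<Rightarrow> {p, q} \<in> edges G" by (intro exI[of _ "(v, w)"]) simp
  next
    fix s :: "'a \<times> 'a" and i :: nat
    assume "case s of (p, q) \<Rightarrow> {p, q} \<in> edges G"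
    then obtain p q where s: "s = (p, q)" "q \<in> verts G" using edge_verts[OF G] by (cases s) auto
    obtain r where "{q, r} \<in> edges G" "r \<noteq> p" using ex_other[OF s(2)] by blast
    then show "\<exists>t. (case t of (p, q) \<Rightarrow> {p, q} \<in> edges G) \<and> fst t = snd s \<and> snd t \<noteq> fst s"
      using s(1) by (intro exI[of _ "(q, r)"]) simp
  qed
  then obtain s where all_s: "\<forall>i. (case s i of (p, q) \<Rightarrow> {p, q} \<in> edges G) \<and>
      fst (s (Suc i)) = snd (s i) \<and> snd (s (Suc i)) \<noteq> fst (s i)" ..
  have s: "case s i of (p, q) \<Rightarrow> {p, q} \<in> edges G" "fst (s (Suc i)) = snd (s i)"
    "snd (s (Suc i)) \<noteq> fst (s i)" for i
    using spec[OF all_s, of i] by simp_all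
  define x where "x i = fst (s i)" for i
  have adj: "{x i, x (Suc i)} \<in> edges G" for i
    using s(1)[of i] s(2)[of i] by (simp add: x_def case_prod_beta)
  have nonback: "x (Suc (Suc i)) \<noteq> x i" for i
    using s(2)[of "Suc i"] s(3)[of i] by (simp add: x_def)
  have xV: "x i \<in> verts G" for i using edge_verts[OF G adj] by blast
  have nbrs_x: "nbrs G (x (Suc i)) = {x i, x (Suc (Suc i))}" for i
    using adj[of i] adj[of "Suc i"] nonback[of i] by (intro nbrs_eq xV) (auto simp: insert_commute)
  have step_neq: "x (Suc i) \<noteq> x i" for i using edge_neq[OF G adj[of i]] by simp
  have finV: "finite (verts G)" using G by (simp add: finite_simple_graph_def)
  have "\<not> inj x"
  proof
    assume "inj x"
    moreover have "finite (range x)" using finV xV by (auto intro: finite_subset)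
    ultimately show False using finite_imageD by blast
  qed
  then have ex: "\<exists>n. \<exists>i<n. x i = x n" unfolding inj_on_def by (metis linorder_neq_iff)
  define n where "n = (LEAST n. \<exists>i<n. x i = x n)"
  obtain i0 where i0: "i0 < n" "x i0 = x n" using LeastI_ex[OF ex] unfolding n_def by blast
  have least: "x i \<noteq> x j" if "i < j" "j < n" for i j
    using not_less_Least[of j "\<lambda>n. \<exists>i<n. x i = x n"] that unfolding n_def by blast
  have inj: "x i = x j \<longleftrightarrow> i = j" if "i < n" "j < n" for i j
    using least[of i j] least[of j i] that by (metis linorder_neq_iff)
  obtain m where m: "n = Suc m" using i0(1) by (cases n) auto
  \<comment> \<open>Were the first repetition at an inner vertex of the walk, \<open>x m\<close>
    would be a neighbour of it. Both neighbours are already on the walk as its predecessor and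
    successor, and equality with either contradicts minimality of \<open>n\<close>, looplessness or
    the ban on turning back.\<close>
  have "i0 = 0"
  proof (rule ccontr)
    assume "i0 \<noteq> 0"
    then obtain i where i: "i0 = Suc i" by (cases i0) auto
    have "x m \<in> nbrs G (x n)" using adj[of m] m by (simp add: nbrs_def insert_commute)
    then have "x m = x i \<or> x m = x (Suc (Suc i))" using nbrs_x[of i] i i0(2) by simp
    then show False
    proof
      assume "x m = x i"
      then show False using inj[of m i] i i0(1) m by simp
    next
      assume xm: "x m = x (Suc (Suc i))"
      show False
      proof (cases "Suc i = m")
        case True
        then show False using xm step_neq[of m] by simp
      next
        case False
        then have "Suc (Suc i) = m" using inj[of m "Suc (Suc i)"] xm i i0(1) m by simp
        then show False using nonback[of "Suc i"] i i0(2) m by simp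
      qed
    qed
  qed
  then have x0: "x n = x 0" using i0(2) by simp
  \<comment> \<open>A closed walk of length 1 would be a loop, one of length 2 would turn
    back.\<close>
  have "n \<noteq> 1" using x0 step_neq[of 0] by auto
  moreover have "n \<noteq> 2" using x0 nonback[of 0] by (auto simp: numeral_2_eq_2)
  ultimately have n3: "n \<ge> 3" using m by simp
  have nbrs_0: "nbrs G (x 0) = {x 1, x m}"
  proof (rule nbrs_eq[OF xV])
    show "{x 0, x 1} \<in> edges G" using adj[of 0] by simp
    show "{x 0, x m} \<in> edges G" using adj[of m] m x0 by (simp add: insert_commute)
    show "x 1 \<noteq> x m" using inj[of 1 m] m n3 by simp
  qed
  have "v \<in> x ` {..<n}" if "v \<in> verts G" for v
  proof (rule connected_closed[OF con _ xV[of 0] that])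
    show "x 0 \<in> x ` {..<n}" using n3 by simp
    fix u y assume "u \<in> x ` {..<n}" and uy: "{u, y} \<in> edges G"
    then obtain i where i: "i < n" "u = x i" by blast
    have y: "y \<in> nbrs G (x i)" using uy i by (simp add: nbrs_def)
    show "y \<in> x ` {..<n}"
    proof (cases i)
      case 0
      then have "y = x 1 \<or> y = x m" using y nbrs_0 by simp
      then show ?thesis using n3 m by auto
    next
      case (Suc k)
      then have "y = x k \<or> y = x (Suc i)" using y nbrs_x[of k] by simp
      moreover have "x (Suc i) \<in> x ` {..<n}"
        using x0 i(1) n3 by (cases "Suc i = n") auto
      moreover have "x k \<in> x ` {..<n}" using i(1) Suc by simp
      ultimately show ?thesis by blast
    qed
  qed
  then have "x ` {..<n} = verts G" using xV by blast
  then have bij: "bij_betw x {..<n} (verts G)"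
    using inj by (simp add: bij_betw_def inj_on_def)
  then have card: "card (verts G) = n" using bij_betw_same_card by fastforce
  with n3 show "card (verts G) \<ge> 3" by simp
  have "{i, j} \<in> edges (cycle_graph n) \<longleftrightarrow> {x i, x j} \<in> edges G" if ij: "i < n" "j < n" for i j
  proof -
    have e: "{x i, x j} \<in> edges G \<longleftrightarrow> x j \<in> nbrs G (x i)" by (simp add: nbrs_def)
    note c = cycle_graph_adj_iff[OF n3 ij]
    show ?thesis
    proof (cases i)
      case 0
      have "x j = x 1 \<longleftrightarrow> j = 1" "x j = x m \<longleftrightarrow> j = m" using inj ij n3 m by simp_all
      then show ?thesis using c e nbrs_0 0 m n3 by auto
    next
      case (Suc k)
      have 1: "{x i, x j} \<in> edges G \<longleftrightarrow> x j = x k \<or> x j = x (Suc i)"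
        using e nbrs_x[of k] Suc by simp
      have 2: "x j = x k \<longleftrightarrow> j = k" using inj[of j k] ij Suc by simp
      have 3: "x j = x (Suc i) \<longleftrightarrow> j = Suc i \<or> (j = 0 \<and> i = m)"
      proof (cases "i = m")
        case True
        then show ?thesis using inj[of j 0] x0 ij m by simp
      next
        case False
        then show ?thesis using inj[of j "Suc i"] ij m by simp
      qed
      show ?thesis unfolding 1 2 3 c using Suc m by auto
    qed
  qed
  with bij have "graph_isomorphism x (cycle_graph n) G"
    by (simp add: graph_isomorphism_def cycle_graph_def)
  then show "isomorphic_graphs (cycle_graph (card (verts G))) G"
    unfolding card isomorphic_graphs_def by (rule exI[of _ x])
qed

lemma distinguishing_number_two_regular_le_2:
  assumes "finite_simple_graph G" "connected_graph G" "card (verts G) \<ge> 6"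
    and "\<And>v. v \<in> verts G \<Longrightarrow> degree G v = 2"
  shows "distinguishing_number G \<le> 2"
proof -
  have "verts G \<noteq> {}" using assms(3) by auto
  from two_regular_isomorphic_cycle_graph(2)[OF assms(1,2) this assms(4)]
  obtain \<phi> where \<phi>: "graph_isomorphism \<phi> (cycle_graph (card (verts G))) G"
    unfolding isomorphic_graphs_def ..
  show ?thesis
    by (rule distinguishing_number_le[OF _ distinguishes_isomorphic[OF \<phi>
          distinguishes_cycle_graph[OF assms(3)]]]) auto
qed

section \<open>Iterated line graphs\<close>

text \<open>Without branching, each edge at \<open>u\<close> has degree sum at most 4. Hence
  \<open>u\<close> has degree exactly 3 and its neighbours are leaves, so by connectedness nothing
  else exists.\<close>

lemma branching_or_claw:
  assumes G: "finite_simple_graph G" and con: "connected_graph G"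
    and u: "u \<in> verts G" "degree G u \<ge> 3" and nb: "\<not> branching G"
  shows "isomorphic_graphs (complete_bipartite_graph 1 3) G"
proof -
  have small: "degree G u + degree G w \<le> 4" if "{u, w} \<in> edges G" for w
  proof (rule ccontr)
    assume "\<not> ?thesis"
    then have "branching G"
      unfolding branching_def using u(2) that by (intro exI[of _ u] exI[of _ w]) simp
    then show False using nb by simp
  qed
  have one: "degree G u = 3" "degree G w = 1" if "{u, w} \<in> edges G" for w
    using small[OF that] u(2) degree_pos[OF G, of w u] that by (simp_all add: insert_commute)
  have card: "card (nbrs G u) \<ge> 3" using u(2) degree_eq_card_nbrs[OF G] by simp
  then have "nbrs G u \<noteq> {}" by auto
  then obtain w where "{u, w} \<in> edges G" by (auto simp: nbrs_def)
  from one(1)[OF this] have "card (nbrs G u) = 3" using degree_eq_card_nbrs[OF G] by simp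
  then obtain a b c where abc: "nbrs G u = {a, b, c}" "a \<noteq> b" "a \<noteq> c" "b \<noteq> c"
    by (auto simp: card_3_iff)
  have leaf: "y = u" if w: "w \<in> {a, b, c}" and y: "{w, y} \<in> edges G" for w y
  proof -
    have wu: "{u, w} \<in> edges G" using w unfolding abc(1)[symmetric] by (simp add: nbrs_def)
    then have "card (nbrs G w) = 1" using one(2) degree_eq_card_nbrs[OF G] by simp
    then obtain z where "nbrs G w = {z}" by (auto simp: card_1_singleton_iff)
    moreover have "y \<in> nbrs G w" "u \<in> nbrs G w"
      using y wu by (simp_all add: nbrs_def insert_commute)
    ultimately show ?thesis by simp
  qed
  have edge_u: "{u, w} \<in> edges G \<longleftrightarrow> w \<in> {a, b, c}" for w
    unfolding abc(1)[symmetric] by (simp add: nbrs_def)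
  have u_ne: "u \<noteq> a" "u \<noteq> b" "u \<noteq> c" using edge_neq[OF G] edge_u by blast+
  have V: "verts G = {u, a, b, c}"
  proof
    show "{u, a, b, c} \<subseteq> verts G" using u(1) edge_u edge_verts[OF G] by blast
    show "verts G \<subseteq> {u, a, b, c}"
    proof
      fix v assume v: "v \<in> verts G"
      show "v \<in> {u, a, b, c}"
      proof (rule connected_closed[OF con _ u(1) v])
        fix x y assume "x \<in> {u, a, b, c}" "{x, y} \<in> edges G"
        then show "y \<in> {u, a, b, c}" using edge_u[of y] leaf[of x y] by (cases "x = u") auto
      qed simp
    qed
  qed
  have edges: "{p, q} \<in> edges G \<longleftrightarrow> (p = u \<and> q \<in> {a, b, c}) \<or> (q = u \<and> p \<in> {a, b, c})"
    if "p \<in> verts G" for p q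
  proof (cases "p = u")
    case True
    then show ?thesis using edge_u[of q] u_ne by auto
  next
    case False
    then have "p \<in> {a, b, c}" using that V by simp
    moreover from this have "{p, u} \<in> edges G" using edge_u[of p] by (simp add: insert_commute)
    ultimately show ?thesis using leaf[of p q] False by blast
  qed
  \<comment> \<open>Index 0, the singleton side of the bipartite graph, becomes the centre
    \<open>u\<close>; indices 1 to 3 become the leaves.\<close>
  define x where "x i = [u, a, b, c] ! i" for i
  have x: "x 0 = u" "x (Suc 0) = a" "x (Suc (Suc 0)) = b" "x (Suc (Suc (Suc 0))) = c"
    by (simp_all add: x_def)
  have lt4: "{..<1 + 3} = {0, Suc 0, Suc (Suc 0), Suc (Suc (Suc 0))}" by auto
  have bij: "bij_betw x {..<1 + 3} (verts G)"
    unfolding lt4 using abc u_ne by (simp add: bij_betw_def V x)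
  have "{i, j} \<in> edges (complete_bipartite_graph 1 3) \<longleftrightarrow> {x i, x j} \<in> edges G"
    if ij: "i \<in> {..<1 + 3}" "j \<in> {..<1 + 3}" for i j
  proof -
    have x_iff: "x k = u \<longleftrightarrow> k = 0" "x k \<in> {a, b, c} \<longleftrightarrow> k \<noteq> 0" if "k \<in> {..<1 + 3}" for k
      using that u_ne unfolding lt4 by (auto simp: x)
    have "{i, j} \<in> edges (complete_bipartite_graph 1 3) \<longleftrightarrow>
        (i = 0 \<and> j \<noteq> 0) \<or> (j = 0 \<and> i \<noteq> 0)"
      using ij by (auto simp: complete_bipartite_graph_def doubleton_eq_iff)
    also have "\<dots> \<longleftrightarrow> {x i, x j} \<in> edges G"
      using x_iff[OF ij(1)] x_iff[OF ij(2)] edges[OF bij_betwE[OF bij, rule_format, OF ij(1)]]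
      by simp
    finally show ?thesis .
  qed
  with bij have "graph_isomorphism x (complete_bipartite_graph 1 3) G"
    unfolding graph_isomorphism_def by (simp add: complete_bipartite_graph_def)
  then show ?thesis unfolding isomorphic_graphs_def by (rule exI[of _ x])
qed

lemma iterated_line_iso:
  assumes "finite_simple_graph G"
  shows "\<exists>l. line_iso (iterated_line_graph k G) (iterated_line_graph (Suc k) G) l"
  using iterated_line_graph_Suc_isomorphic[OF assms, of k] finite_simple_iterated_line_graph[OF assms]
  unfolding isomorphic_graphs_def line_iso_def by blast

lemma connected_iterated_line_graph:
  assumes G: "finite_simple_graph G" and "connected_graph G"
  shows "connected_graph (iterated_line_graph k G)"
proof (induction k)
  case 0
  show ?case
    using connected_graph_isomorphic[OF assms iterated_line_graph_0_isomorphic[OF G]] .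
next
  case (Suc k)
  obtain l where "line_iso (iterated_line_graph k G) (iterated_line_graph (Suc k) G) l"
    using iterated_line_iso[OF G] ..
  from line_iso.connected_line[OF this Suc] show ?case .
qed

lemma distinguishing_number_empty: "verts G = {} \<Longrightarrow> distinguishing_number G \<le> k"
  by (rule distinguishing_number_le) (auto simp: distinguishes_def)

theorem theorem6:
  fixes G :: "'a graph"
  assumes "finite_simple_graph G"
    and "connected_graph G"
    and "\<not> isomorphic_graphs G (cycle_graph 3)"
    and "\<not> isomorphic_graphs G (cycle_graph 4)"
    and "\<not> isomorphic_graphs G (cycle_graph 5)"
    and "\<not> isomorphic_graphs G (complete_bipartite_graph 1 3)"
  shows "\<exists>K. \<forall>k\<ge>K. distinguishing_number (iterated_line_graph k G) \<le> 2"
proof -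
  define L where "L k = iterated_line_graph k G" for k
  have fs: "finite_simple_graph (L k)" for k
    unfolding L_def by (rule finite_simple_iterated_line_graph[OF assms(1)])
  have con: "connected_graph (L k)" for k
    unfolding L_def by (rule connected_iterated_line_graph[OF assms(1,2)])
  have "\<exists>l. \<forall>k. line_iso (L k) (L (Suc k)) (l k)"
    unfolding L_def by (intro choice allI iterated_line_iso[OF assms(1)])
  then obtain l where line: "\<And>k. line_iso (L k) (L (Suc k)) (l k)" by blast
  have not_iso: "\<not> isomorphic_graphs H (L 0)" if "\<not> isomorphic_graphs G H" for H :: "nat graph"
    using that isomorphic_graphs_trans[OF iterated_line_graph_0_isomorphic[OF assms(1)]
        isomorphic_graphs_sym, of H] unfolding L_def by blast
  consider (branch) v where "v \<in> verts (L 0)" "degree (L 0) v \<ge> 3"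
    | (path) "\<And>v. v \<in> verts (L 0) \<Longrightarrow> degree (L 0) v \<le> 2"
        "verts (L 0) = {} \<or> (\<exists>v\<in>verts (L 0). degree (L 0) v \<le> 1)"
    | (cycle) "\<And>v. v \<in> verts (L 0) \<Longrightarrow> degree (L 0) v = 2" "verts (L 0) \<noteq> {}"
    by (metis One_nat_def Suc_1 Suc_le_eq le_SucE not_less numeral_3_eq_3)
  then have "\<exists>K. \<forall>k\<ge>K. distinguishing_number (L k) \<le> 2"
  proof cases
    case path
    have "((\<forall>v\<in>verts (L k). degree (L k) v \<le> 2) \<and>
        (verts (L k) = {} \<or> (\<exists>v\<in>verts (L k). degree (L k) v \<le> 1))) \<and>
        card (verts (L k)) \<le> card (verts (L 0)) - k" for k
    proof (induction k)
      case (Suc k)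
      note P = line_iso.path_line[OF line con]
      show ?case using P[of k] Suc by fastforce
    qed (use path in simp)
    then have empty: "card (verts (L k)) = 0" if "k \<ge> card (verts (L 0))" for k
      using that by (metis diff_is_0_eq le_zero_eq)
    have "verts (L k) = {}" if "k \<ge> card (verts (L 0))" for k
      using empty[OF that] fs[of k] by (simp add: finite_simple_graph_def)
    then show ?thesis
      by (intro exI[of _ "card (verts (L 0))"] allI impI distinguishing_number_empty)
  next
    case cycle
    have reg: "(\<forall>v\<in>verts (L k). degree (L k) v = 2) \<and> card (verts (L k)) = card (verts (L 0))" for k
    proof (induction k)
      case (Suc k)
      then show ?case using line_iso.two_regular_line[OF line, of k] by simp
    qed (use cycle in simp)
    note iso = two_regular_isomorphic_cycle_graph[OF fs con cycle(2,1)]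
    \<comment> \<open>The excluded cycles leave at least 6 vertices, and by \<open>reg\<close> this
      number is the same for every iterate.\<close>
    have "card (verts (L 0)) \<noteq> 3" "card (verts (L 0)) \<noteq> 4" "card (verts (L 0)) \<noteq> 5"
      using iso(2) not_iso[OF assms(3)] not_iso[OF assms(4)] not_iso[OF assms(5)] by metis+
    with iso(1) have "card (verts (L 0)) \<ge> 6" by simp
    then have "distinguishing_number (L k) \<le> 2" for k
      using reg[of k] by (intro distinguishing_number_two_regular_le_2 fs con) simp_all
    then show ?thesis by blast
  next
    case branch
    have br: "branching (L k)" for k
    proof (induction k)
      case 0
      show ?case using branching_or_claw[OF fs con branch] not_iso[OF assms(6)] by blast
    next
      case (Suc k)
      then show ?case by (rule line_iso.branching_line[OF line])
    qed
    have "defect (L k) \<le> defect (L 0) - k" for k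
    proof (induction k)
      case (Suc k)
      then show ?case using line_iso.defect_line[OF line con br, of k] by simp
    qed simp
    then have "defect (L (defect (L 0))) = 0" by (metis diff_self_eq_0 le_zero_eq)
    then obtain d where d: "defect (L d) = 0" ..
    have deg: "3 + j \<le> degree (L (d + j)) v" if "v \<in> verts (L (d + j))" for j v
      using that
    proof (induction j arbitrary: v)
      case 0
      then show ?case using d fs[of d] by (simp add: defect_def finite_simple_graph_def)
    next
      case (Suc j)
      then show ?case using line_iso.min_degree_line[OF line, of "d + j" j v] by simp
    qed
    \<comment> \<open>One step after \<open>d\<close> the minimum degree is at least 4, so from
      \<open>L (Suc d)\<close> on the automorphism group cannot grow.\<close>
    define N where "N = card (automorphisms (L (Suc d)))"
    have N: "card (automorphisms (L (Suc d + j))) \<le> N" for j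
    proof (induction j)
      case (Suc j)
      have "card (automorphisms (L (Suc (Suc d + j)))) \<le> card (automorphisms (L (Suc d + j)))"
      proof (rule line_iso.card_automorphisms_line[OF line])
        show "4 \<le> degree (L (Suc d + j)) v" if "v \<in> verts (L (Suc d + j))" for v
          using deg[of v "Suc j"] that by simp
      qed
      then show ?case using Suc by simp
    qed (simp add: N_def)
    have "distinguishing_number (L k) \<le> 2" if k: "k \<ge> Suc (Suc d) + N" for k
    proof -
      \<comment> \<open>The graph before \<open>L k\<close> is then
        \<open>L (d + Suc (N + j))\<close>, with minimum degree at least 4 + N + j. This exceeds
        \<open>N\<close>, which bounds the number of automorphisms of \<open>L k\<close>.\<close>
      obtain j where j: "k = Suc (d + Suc (N + j))" using k by (metis add_Suc_right add_Suc add.assoc le_Suc_ex)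
      show ?thesis
        unfolding j
      proof (rule line_iso.distinguishing_number_line_le_2[OF line])
        fix v assume "v \<in> verts (L (d + Suc (N + j)))"
        from deg[OF this] have "3 + Suc (N + j) \<le> degree (L (d + Suc (N + j))) v" .
        moreover have "card (automorphisms (L (Suc (d + Suc (N + j))))) \<le> N"
          using N[of "Suc (N + j)"] by simp
        ultimately show "4 \<le> degree (L (d + Suc (N + j))) v \<and>
            Suc (card (automorphisms (L (Suc (d + Suc (N + j)))))) \<le> degree (L (d + Suc (N + j))) v"
          by simp
      qed
    qed
    then show ?thesis by blast
  qed
  then show ?thesis unfolding L_def .
qed

end
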